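(* Let $k$ be an integer and let $(E_N)_{N\in\mathbb{N}}\in\prod_{N=1}^{\infty}\mathbb{C}[\mathcal{P}_k(N)]$. The sequence $(E_N)_{N\in\mathbb{N}}$ converges (in moments) if and only if one of the following two conditions holds (each of them being equivalent to convergence): 1. for any $p\in\mathcal{P}_k$, $m_{p^c}(E_N)$ converges as $N$ goes to infinity, to a number denoted by $m_{p^c}(E)$; 2. for any $p\in\mathcal{P}_k$, $\kappa_{p^c}(E_N)$ converges as $N$ goes to infinity, to a number denoted by $\kappa_{p^c}(E)$. If $(E_N)_{N\in\mathbb{N}}$ converges, then for any $p\in\mathcal{P}_k$, $$m_p(E)=\sum_{p'\dashv p}m_{p'^c}(E),\qquad \kappa_{p^c}(E)=\sum_{p'\sqsupset p}\kappa_{p'}(E),$$ where $m_p(E)=\lim_Nm_p(E_N)$ and $\kappa_p(E)=\lim_N\kappa_p(E_N)$.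
   Context: $\mathcal{P}_k$ is the set of partitions of $\{1,\dots,k\}\cup\{1',\dots,k'\}$ ($1,\dots,k$ top row, $1',\dots,k'$ bottom row), $\mathrm{id}_k=\{\{i,i'\}:1\le i\le k\}$. $\mathrm{nc}(p)$ is the number of blocks, $p\vee p'$ the finest partition coarser than both; $p\trianglelefteq p'$ means that $p$ is finer than $p'$. Orders: $p'\dashv p$ if $p'$ is coarser than $p$ and $\mathrm{nc}(p'\vee\mathrm{id}_k)=\mathrm{nc}(p\vee\mathrm{id}_k)$; $p'\sqsupset p$ if $p'$ is finer than $p$ and $\mathrm{nc}(p')-\mathrm{nc}(p'\vee\mathrm{id}_k)=\mathrm{nc}(p)-\mathrm{nc}(p\vee\mathrm{id}_k)$. Composition: $p\circ p'$ is obtained by putting a diagram of $p'$ above one of $p$, identifying the bottom vertex $i'$ of $p'$ with the top vertex $i$ of $p$, and taking the partition of top and bottom rows induced by the connected components; $\kappa(p,p')$ is the number of connected components entirely contained in the middle row. ${}^tp$ is $p$ with $i$ and $i'$ exchanged for all $i$, extended linearly. The partition algebra $\mathbb{C}[\mathcal{P}_k(N)]$ has basis $\mathcal{P}_k$ and product $p_1p_2=N^{\kappa(p_1,p_2)}(p_1\circ p_2)$. $\mathrm{Tr}_N$ is the linear form with $\mathrm{Tr}_N(p)=N^{\mathrm{nc}(p\vee\mathrm{id}_k)}$. The exclusive basis $(p^c)_{p\in\mathcal{P}_k}$ of $\mathbb{C}[\mathcal{P}_k]$ is the unique family such that $p=\sum_{p\trianglelefteq p'}p'^c$ for every $p\in\mathcal{P}_k$.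 For $E\in\mathbb{C}[\mathcal{P}_k(N)]$ and $p\in\mathcal{P}_k$: $m_p(E)=\frac{1}{\mathrm{Tr}_N(p)}\mathrm{Tr}_N(E\,{}^tp)$; $\kappa_p(E)=N^{\mathrm{nc}(p)-\mathrm{nc}(p\vee\mathrm{id}_k)}E_p$ with $E_p$ the coordinate of $E$ on $p$ in the basis $\mathcal{P}_k$; $m_{p^c}(E)=\frac{1}{\mathrm{Tr}_N(p)}\mathrm{Tr}_N(E\,{}^tp^c)$; $\kappa_{p^c}(E)=N^{\mathrm{nc}(p)-\mathrm{nc}(p\vee\mathrm{id}_k)}E_{p^c}$ with $E_{p^c}$ the coordinate of $E$ on $p^c$ in the exclusive basis. $(E_N)_N$ converges (in moments) if $m_p(E_N)$ converges for every $p\in\mathcal{P}_k$; it is known that then $\kappa_p(E_N)$ also converges for every $p\in\mathcal{P}_k$. *)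

theory Defs
  imports "HOL-Analysis.Analysis"
begin

section \<open>Partitions\<close>

text \<open>The vertex \<open>i\<close> of the top row is \<open>Top i\<close>, the vertex \<open>i'\<close> of the bottom row is \<open>Bot i\<close>.\<close>

datatype vertex = Top nat | Bot nat

type_synonym diagram = "vertex set set"

definition vertices :: "nat \<Rightarrow> vertex set" where
  "vertices k = Top ` {1..k} \<union> Bot ` {1..k}"

definition partitions :: "nat \<Rightarrow> diagram set" where
  "partitions k = {p. partition_on (vertices k) p}"

definition id_part :: "nat \<Rightarrow> diagram" where
  "id_part k = (\<lambda>i. {Top i, Bot i}) ` {1..k}"

abbreviation nc :: "diagram \<Rightarrow> nat" where
  "nc p \<equiv> card p"

abbreviation finer :: "nat \<Rightarrow> diagram \<Rightarrow> diagram \<Rightarrow> bool" where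
  "finer k p p' \<equiv> refines (vertices k) p p'"

definition join :: "nat \<Rightarrow> diagram \<Rightarrow> diagram \<Rightarrow> diagram" where
  "join k p p' = (THE r. finer k p r \<and> finer k p' r \<and>
     (\<forall>s. finer k p s \<and> finer k p' s \<longrightarrow> finer k r s))"

definition nc_id :: "nat \<Rightarrow> diagram \<Rightarrow> nat" where
  "nc_id k p = nc (join k p (id_part k))"

text \<open>\<open>dashv k p' p\<close> and \<open>sqsupset k p' p\<close> stand for \<open>p' \<stileturn> p\<close> and \<open>p' \<sqsupset> p\<close>.\<close>

definition dashv :: "nat \<Rightarrow> diagram \<Rightarrow> diagram \<Rightarrow> bool" where
  "dashv k p' p \<longleftrightarrow> finer k p p' \<and> nc_id k p' = nc_id k p"

definition sqsupset :: "nat \<Rightarrow> diagram \<Rightarrow> diagram \<Rightarrow> bool" where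
  "sqsupset k p' p \<longleftrightarrow> finer k p' p \<and>
     int (nc p') - int (nc_id k p') = int (nc p) - int (nc_id k p)"

fun flip :: "vertex \<Rightarrow> vertex" where
  "flip (Top i) = Bot i"
| "flip (Bot i) = Top i"

definition transpose_part :: "diagram \<Rightarrow> diagram" where
  "transpose_part p = (\<lambda>B. flip ` B) ` p"


section \<open>Composition\<close>

text \<open>
  To compose \<open>p \<circ> p'\<close>, the diagram of \<open>p'\<close> is drawn on the rows \<open>Upper\<close>, \<open>Middle\<close> and
  the diagram of \<open>p\<close> on the rows \<open>Middle\<close>, \<open>Lower\<close>.
\<close>

datatype stacked_vertex = Upper nat | Middle nat | Lower nat

fun place_above :: "vertex \<Rightarrow> stacked_vertex" where
  "place_above (Top i) = Upper i"
| "place_above (Bot i) = Middle i"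

fun place_below :: "vertex \<Rightarrow> stacked_vertex" where
  "place_below (Top i) = Middle i"
| "place_below (Bot i) = Lower i"

fun outer :: "vertex \<Rightarrow> stacked_vertex" where
  "outer (Top i) = Upper i"
| "outer (Bot i) = Lower i"

definition stacked_vertices :: "nat \<Rightarrow> stacked_vertex set" where
  "stacked_vertices k = Upper ` {1..k} \<union> Middle ` {1..k} \<union> Lower ` {1..k}"

definition stacked_edges :: "diagram \<Rightarrow> diagram \<Rightarrow> (stacked_vertex \<times> stacked_vertex) set" where
  "stacked_edges p p' =
     (\<Union>B\<in>p'. place_above ` B \<times> place_above ` B) \<union> (\<Union>B\<in>p. place_below ` B \<times> place_below ` B)"

definition components :: "nat \<Rightarrow> diagram \<Rightarrow> diagram \<Rightarrow> stacked_vertex set set" where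
  "components k p p' = stacked_vertices k // (stacked_edges p p')\<^sup>*"

definition compose_part :: "nat \<Rightarrow> diagram \<Rightarrow> diagram \<Rightarrow> diagram" where
  "compose_part k p p' = (\<lambda>C. outer -` C) ` components k p p' - {{}}"

definition loops :: "nat \<Rightarrow> diagram \<Rightarrow> diagram \<Rightarrow> nat" where
  "loops k p p' = card {C \<in> components k p p'. C \<subseteq> Middle ` {1..k}}"


section \<open>The partition algebra\<close>

text \<open>An element of \<open>\<complex>[\<P>\<^sub>k]\<close> is identified with the family of its coordinates in the
  basis \<open>\<P>\<^sub>k\<close>.\<close>

type_synonym element = "diagram \<Rightarrow> complex"

definition partition_algebra :: "nat \<Rightarrow> element set" where
  "partition_algebra k = {a. \<forall>p. p \<notin> partitions k \<longrightarrow> a p = 0}"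

definition basis :: "diagram \<Rightarrow> element" where
  "basis p = (\<lambda>q. if q = p then 1 else 0)"

definition mult :: "nat \<Rightarrow> nat \<Rightarrow> element \<Rightarrow> element \<Rightarrow> element" where
  "mult k N a b = (\<lambda>q. \<Sum>p\<^sub>1\<in>partitions k. \<Sum>p\<^sub>2\<in>partitions k.
     a p\<^sub>1 * b p\<^sub>2 * (of_nat N ^ loops k p\<^sub>1 p\<^sub>2 * basis (compose_part k p\<^sub>1 p\<^sub>2) q))"

definition transp :: "nat \<Rightarrow> element \<Rightarrow> element" where
  "transp k a = (\<lambda>q. \<Sum>p\<in>partitions k. a p * basis (transpose_part p) q)"

definition Tr :: "nat \<Rightarrow> nat \<Rightarrow> element \<Rightarrow> complex" where
  "Tr k N a = (\<Sum>p\<in>partitions k. a p * of_nat N ^ nc_id k p)"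


section \<open>The exclusive basis\<close>

definition is_exclusive_family :: "nat \<Rightarrow> (diagram \<Rightarrow> element) \<Rightarrow> bool" where
  "is_exclusive_family k f \<longleftrightarrow> f \<in> (partitions k \<rightarrow>\<^sub>E partition_algebra k) \<and>
     (\<forall>p\<in>partitions k. basis p = (\<lambda>q. \<Sum>p' | p' \<in> partitions k \<and> finer k p p'. f p' q))"

definition exclusive :: "nat \<Rightarrow> diagram \<Rightarrow> element" where
  "exclusive k = (THE f. is_exclusive_family k f)"

definition is_exclusive_coords :: "nat \<Rightarrow> element \<Rightarrow> (diagram \<Rightarrow> complex) \<Rightarrow> bool" where
  "is_exclusive_coords k a c \<longleftrightarrow> (\<forall>p. p \<notin> partitions k \<longrightarrow> c p = 0) \<and>
     a = (\<lambda>q. \<Sum>p\<in>partitions k. c p * exclusive k p q)"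

definition exclusive_coord :: "nat \<Rightarrow> element \<Rightarrow> diagram \<Rightarrow> complex" where
  "exclusive_coord k a = (THE c. is_exclusive_coords k a c)"


section \<open>Moments and cumulants\<close>

definition moment :: "nat \<Rightarrow> nat \<Rightarrow> diagram \<Rightarrow> element \<Rightarrow> complex" where
  "moment k N p a = 1 / Tr k N (basis p) * Tr k N (mult k N a (transp k (basis p)))"

definition cumulant :: "nat \<Rightarrow> nat \<Rightarrow> diagram \<Rightarrow> element \<Rightarrow> complex" where
  "cumulant k N p a = of_nat N powi (int (nc p) - int (nc_id k p)) * a p"

definition exclusive_moment :: "nat \<Rightarrow> nat \<Rightarrow> diagram \<Rightarrow> element \<Rightarrow> complex" where
  "exclusive_moment k N p a =
     1 / Tr k N (basis p) * Tr k N (mult k N a (transp k (exclusive k p)))"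

definition exclusive_cumulant :: "nat \<Rightarrow> nat \<Rightarrow> diagram \<Rightarrow> element \<Rightarrow> complex" where
  "exclusive_cumulant k N p a =
     of_nat N powi (int (nc p) - int (nc_id k p)) * exclusive_coord k a p"

definition converges_in_moments :: "nat \<Rightarrow> (nat \<Rightarrow> element) \<Rightarrow> bool" where
  "converges_in_moments k E \<longleftrightarrow> (\<forall>p\<in>partitions k. convergent (\<lambda>N. moment k N p (E N)))"


section \<open>The descriptions used above determine their objects\<close>

lemma finite_partitions: "finite (partitions k)"
  unfolding partitions_def by (rule finitely_many_partition_on) (simp add: vertices_def)

lemma basis_in_partition_algebra: "p \<in> partitions k \<Longrightarrow> basis p \<in> partition_algebra k"
  by (auto simp: basis_def partition_algebra_def)

lemma finer_partitions: "finer k p q \<Longrightarrow> p \<in> partitions k \<and> q \<in> partitions k"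
  by (auto simp: refines_def partitions_def)

lemma id_part_in_partitions: "id_part k \<in> partitions k"
  unfolding partitions_def id_part_def vertices_def
  by (auto simp: partition_on_def disjoint_def)

lemma join_exists1:
  assumes "p \<in> partitions k" "q \<in> partitions k"
  shows "\<exists>!r. finer k p r \<and> finer k q r \<and> (\<forall>s. finer k p s \<and> finer k q s \<longrightarrow> finer k r s)"
proof -
  let ?S = "{r. finer k p r \<and> finer k q r}"
  have pq: "partition_on (vertices k) p" "partition_on (vertices k) q"
    using assms by (auto simp: partitions_def)
  have ne: "?S \<noteq> {}"
  proof (cases "vertices k = {}")
    case True
    then have "p = {}" "q = {}" using pq by (auto simp: partition_on_empty)
    then show ?thesis using pq by (auto intro: refines_refl)
  next
    case False
    then have "partition_on (vertices k) {vertices k}" by (rule partition_on_space)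
    then have "{vertices k} \<in> ?S" using pq by (auto simp: refines_def partition_on_def)
    then show ?thesis by blast
  qed
  have part: "partition_on (vertices k) r" if "r \<in> ?S" for r
    using that by (auto simp: refines_def)
  have up: "finer k p (common_refinement ?S)" "finer k q (common_refinement ?S)"
    by (rule common_refinement_coarsest[OF part]; use pq ne in auto)+
  have least: "finer k (common_refinement ?S) s" if "s \<in> ?S" for s
    by (rule refines_common_refinement[OF part that])
  show ?thesis
  proof (rule ex1I[of _ "common_refinement ?S"])
    fix r assume r: "finer k p r \<and> finer k q r \<and> (\<forall>s. finer k p s \<and> finer k q s \<longrightarrow> finer k r s)"
    then have "finer k r (common_refinement ?S)" using up by blast
    moreover have "finer k (common_refinement ?S) r" using least r by blast
    ultimately show "r = common_refinement ?S" by (rule refines_asym)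
  qed (use up least in auto)
qed

lemma join_in_partitions:
  assumes "p \<in> partitions k" "q \<in> partitions k"
  shows "join k p q \<in> partitions k"
  using theI'[OF join_exists1[OF assms]] unfolding join_def by (blast dest: finer_partitions)

lemma compose_part_in_partitions:
  assumes "p \<in> partitions k" "p' \<in> partitions k"
  shows "compose_part k p p' \<in> partitions k"
proof -
  let ?V = "stacked_vertices k" and ?R = "stacked_edges p p'"
  have V: "\<Union>p = vertices k" "\<Union>p' = vertices k"
    using assms by (auto simp: partitions_def partition_on_def)
  have sub: "place_above v \<in> ?V" "place_below v \<in> ?V" if "v \<in> vertices k" for v
    using that by (auto simp: vertices_def stacked_vertices_def)
  have RV: "?R \<subseteq> ?V \<times> ?V"
    unfolding stacked_edges_def
  proof (intro Un_least UN_least)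
    fix B assume "B \<in> p'"
    then have "place_above ` B \<subseteq> ?V" using sub(1) V(2) by blast
    then show "place_above ` B \<times> place_above ` B \<subseteq> ?V \<times> ?V" by blast
  next
    fix B assume "B \<in> p"
    then have "place_below ` B \<subseteq> ?V" using sub(2) V(1) by blast
    then show "place_below ` B \<times> place_below ` B \<subseteq> ?V \<times> ?V" by blast
  qed
  have closed: "y \<in> ?V" if "(x, y) \<in> ?R\<^sup>*" "x \<in> ?V" for x y
    using that by (induction rule: rtrancl_induct) (use RV in blast)+
  have "sym ?R" by (auto simp: stacked_edges_def sym_def)
  then have symR: "sym (?R\<^sup>*)" by (rule sym_rtrancl)
  have "equiv ?V (?R\<^sup>* \<inter> ?V \<times> ?V)"
  proof (rule equivI)
    show "trans (?R\<^sup>* \<inter> ?V \<times> ?V)"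
      by (intro trans_Int trans_rtrancl) (auto simp: trans_def)
    show "sym (?R\<^sup>* \<inter> ?V \<times> ?V)"
      by (intro sym_Int symR) (auto simp: sym_def)
  qed (auto simp: refl_on_def)
  moreover have "components k p p' = ?V // (?R\<^sup>* \<inter> ?V \<times> ?V)"
  proof -
    have "?R\<^sup>* `` {x} = (?R\<^sup>* \<inter> ?V \<times> ?V) `` {x}" if "x \<in> ?V" for x
      using closed that by blast
    then show ?thesis by (simp add: components_def quotient_def)
  qed
  ultimately have "partition_on ?V (components k p p')"
    by (simp add: partition_on_quotient)
  then have "partition_on (outer -` ?V) (compose_part k p p')"
    unfolding compose_part_def by (rule partition_on_vimage)
  moreover have "outer -` ?V = vertices k"
    unfolding vertices_def stacked_vertices_def by (auto; case_tac x; auto)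
  ultimately show ?thesis by (simp add: partitions_def)
qed

lemma transpose_part_in_partitions:
  assumes "p \<in> partitions k"
  shows "transpose_part p \<in> partitions k"
proof -
  have inj: "inj flip"
    by (rule injI) (metis flip.simps vertex.exhaust)
  have "partition_on (flip ` vertices k) (transpose_part p)"
  proof -
    have "transpose_part p = (`) flip ` p - {{}}"
      using assms by (auto simp: transpose_part_def partitions_def partition_on_def)
    then show ?thesis
      using assms partition_on_inj_image[of "vertices k" p flip] inj
      by (simp add: partitions_def inj_on_subset[OF inj])
  qed
  moreover have "flip ` vertices k = vertices k"
    by (auto simp: vertices_def image_Un image_image)
  ultimately show ?thesis by (simp add: partitions_def)
qed

lemma exclusive_family_basis:
  assumes "is_exclusive_family k f" "p \<in> partitions k"
  shows "basis p q = (\<Sum>p' | p' \<in> partitions k \<and> finer k p p'. f p' q)"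
  using assms unfolding is_exclusive_family_def by (blast dest: fun_cong)

lemma exclusive_family_exists1: "\<exists>!f. is_exclusive_family k f"
proof -
  let ?P = "partitions k"
  define U where "U p = {p' \<in> ?P. finer k p p'}" for p
  have finU: "finite (U p)" for p using finite_partitions by (simp add: U_def)
  have selfU: "p \<in> U p" if "p \<in> ?P" for p
    using that refines_refl by (auto simp: U_def partitions_def)
  have subU: "U p' \<subset> U p" if "p \<in> ?P" "p' \<in> U p" "p' \<noteq> p" for p p'
  proof
    show "U p' \<subseteq> U p" using that by (auto simp: U_def intro: refines_trans)
    show "U p' \<noteq> U p"
      using selfU[OF that(1)] that by (auto simp: U_def dest: refines_asym)
  qed
  have cardU: "card (U p') < card (U p)" if "p \<in> ?P" "p' \<in> U p - {p}" for p p'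
    using subU[of p p'] that by (intro psubset_card_mono[OF finU]) blast
  have split: "(\<Sum>p'\<in>U p. g p') = g p + (\<Sum>p'\<in>U p - {p}. g p')"
    if "p \<in> ?P" for p and g :: "diagram \<Rightarrow> complex"
    using selfU[OF that] finU by (simp add: sum.remove)
  define ok where "ok f n \<longleftrightarrow> (\<forall>p\<in>?P. card (U p) \<le> n \<longrightarrow>
      f p \<in> partition_algebra k \<and> (\<forall>q. basis p q = (\<Sum>p'\<in>U p. f p' q)))"
    for f :: "diagram \<Rightarrow> element" and n
  have "\<exists>f. ok f n" for n
  proof (induction n)
    case 0
    have "card (U p) \<noteq> 0" if "p \<in> ?P" for p using selfU[OF that] finU by auto
    then show ?case unfolding ok_def by (metis le_zero_eq)
  next
    case (Suc n)
    then obtain f where f: "ok f n" by blast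
    define g where "g p = (if card (U p) \<le> n then f p
        else (\<lambda>q. basis p q - (\<Sum>p'\<in>U p - {p}. f p' q)))" for p
    have "ok g (Suc n)"
      unfolding ok_def
    proof (intro ballI impI)
      fix p assume p: "p \<in> ?P" and le: "card (U p) \<le> Suc n"
      have gf: "g p' = f p'" if "p' \<in> U p - {p}" for p'
        using cardU[OF p that] le by (simp add: g_def)
      have fA: "f p' \<in> partition_algebra k" if "p' \<in> U p - {p}" for p'
        using cardU[OF p that] le that f by (auto simp: ok_def U_def)
      have s: "(\<Sum>p'\<in>U p. g p' q) = g p q + (\<Sum>p'\<in>U p - {p}. f p' q)" for q
        using gf by (simp add: split[OF p])
      show "g p \<in> partition_algebra k \<and> (\<forall>q. basis p q = (\<Sum>p'\<in>U p. g p' q))"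
      proof (cases "card (U p) \<le> n")
        case True
        then show ?thesis using f p s by (simp add: ok_def g_def split)
      next
        case False
        then have "g p = (\<lambda>q. basis p q - (\<Sum>p'\<in>U p - {p}. f p' q))" by (simp add: g_def)
        moreover from this have "g p \<in> partition_algebra k"
          using basis_in_partition_algebra[OF p] fA
          by (auto simp: partition_algebra_def intro!: sum.neutral)
        ultimately show ?thesis using s by simp
      qed
    qed
    then show ?case by blast
  qed
  then obtain f where f: "ok f (card ?P)" by blast
  have le: "card (U p) \<le> card ?P" for p
    using finite_partitions by (auto simp: U_def intro: card_mono)
  have "is_exclusive_family k (restrict f ?P)"
  proof -
    have "basis p q = (\<Sum>p'\<in>U p. restrict f ?P p' q)" if "p \<in> ?P" for p q
    proof -
      have "basis p q = (\<Sum>p'\<in>U p. f p' q)" using f le that by (simp add: ok_def)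
      also have "\<dots> = (\<Sum>p'\<in>U p. restrict f ?P p' q)"
        by (rule sum.cong) (auto simp: U_def)
      finally show ?thesis .
    qed
    then show ?thesis using f le
      by (auto simp: is_exclusive_family_def ok_def U_def[symmetric] fun_eq_iff)
  qed
  moreover have "g = h" if g: "is_exclusive_family k g" and h: "is_exclusive_family k h" for g h
  proof -
    have eq: "g p = h p" if "p \<in> ?P" for p
      using that
    proof (induction "card (U p)" arbitrary: p rule: less_induct)
      case less
      have sg: "basis p q = (\<Sum>p'\<in>U p. g p' q)" and sh: "basis p q = (\<Sum>p'\<in>U p. h p' q)" for q
        using exclusive_family_basis[OF g less.prems] exclusive_family_basis[OF h less.prems]
        unfolding U_def by simp_all
      have "g p' = h p'" if "p' \<in> U p - {p}" for p'
        using less.hyps[OF cardU[OF less.prems that]] that by (simp add: U_def)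
      then have "(\<Sum>p'\<in>U p - {p}. g p' q) = (\<Sum>p'\<in>U p - {p}. h p' q)" for q by simp
      then show ?case
        using sg sh split[OF less.prems] by (metis (no_types, lifting) add_right_cancel ext)
    qed
    show ?thesis
      by (rule PiE_ext[of _ ?P "\<lambda>_. partition_algebra k"])
        (use g h eq in \<open>auto simp: is_exclusive_family_def\<close>)
  qed
  ultimately show ?thesis by blast
qed

lemma is_exclusive_family_exclusive: "is_exclusive_family k (exclusive k)"
  unfolding exclusive_def by (rule theI'[OF exclusive_family_exists1])

lemma exclusive_coords_exist1:
  assumes a: "a \<in> partition_algebra k"
  shows "\<exists>!c. is_exclusive_coords k a c"
proof -
  let ?P = "partitions k" and ?e = "exclusive k"
  have exp: "basis p q = (\<Sum>p'\<in>?P. if finer k p p' then ?e p' q else 0)" if "p \<in> ?P" for p q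
  proof -
    have "basis p q = (\<Sum>p' | p' \<in> ?P \<and> finer k p p'. ?e p' q)"
      by (rule exclusive_family_basis[OF is_exclusive_family_exclusive that])
    then show ?thesis by (simp add: sum.inter_filter[OF finite_partitions])
  qed
  have eA: "?e p q = 0" if "p \<in> ?P" "q \<notin> ?P" for p q
    using is_exclusive_family_exclusive that
    by (auto simp: is_exclusive_family_def partition_algebra_def)
  have rf: "finer k p p" if "p \<in> ?P" for p using that refines_refl by (auto simp: partitions_def)
  define c where "c p' = (if p' \<in> ?P then \<Sum>p\<in>?P. if finer k p p' then a p else 0 else 0)" for p'
  have "a q = (\<Sum>p'\<in>?P. c p' * ?e p' q)" for q
  proof -
    have "a q = (\<Sum>p\<in>?P. a p * basis p q)"
      using a finite_partitions[of k]
      by (auto simp: basis_def partition_algebra_def if_distrib sum.delta cong: if_cong)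
    also have "\<dots> = (\<Sum>p\<in>?P. \<Sum>p'\<in>?P. a p * (if finer k p p' then ?e p' q else 0))"
      by (simp add: exp sum_distrib_left)
    also have "\<dots> = (\<Sum>p'\<in>?P. \<Sum>p\<in>?P. a p * (if finer k p p' then ?e p' q else 0))"
      by (rule sum.swap)
    also have "\<dots> = (\<Sum>p'\<in>?P. c p' * ?e p' q)"
      by (auto simp: c_def sum_distrib_right intro!: sum.cong)
    finally show ?thesis .
  qed
  then have ex: "is_exclusive_coords k a c"
    by (auto simp: is_exclusive_coords_def c_def)
  define U where "U p = {p' \<in> ?P. finer k p p'}" for p
  have finU: "finite (U p)" for p using finite_partitions by (simp add: U_def)
  have cardU: "card (U p') < card (U p)" if "p \<in> ?P" "finer k p p'" "p' \<noteq> p" for p p'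
  proof (rule psubset_card_mono[OF finU])
    have "U p' \<subseteq> U p" using that by (auto simp: U_def intro: refines_trans)
    moreover have "p \<in> U p - U p'" using that rf by (auto simp: U_def dest: refines_asym)
    ultimately show "U p' \<subset> U p" by blast
  qed
  have sumU: "(\<Sum>p'\<in>?P. if finer k p p' then g p' else 0) = g p + (\<Sum>p'\<in>U p - {p}. g p')"
    if "p \<in> ?P" for p and g :: "diagram \<Rightarrow> complex"
  proof -
    have "p \<in> U p" using that rf by (simp add: U_def)
    then have "(\<Sum>p'\<in>U p. g p') = g p + (\<Sum>p'\<in>U p - {p}. g p')"
      using finU by (simp add: sum.remove)
    then show ?thesis by (simp add: U_def sum.inter_filter[OF finite_partitions])
  qed
  have tri: "\<forall>q. ?e p q \<noteq> 0 \<longrightarrow> finer k p q" if "p \<in> ?P" for p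
    using that
  proof (induction "card (U p)" arbitrary: p rule: less_induct)
    case less
    show ?case
    proof (intro allI impI, rule ccontr)
      fix q assume q: "?e p q \<noteq> 0" "\<not> finer k p q"
      have "?e p' q = 0" if "p' \<in> U p - {p}" for p'
      proof -
        have p': "p' \<in> ?P" "finer k p p'" "p' \<noteq> p" using that by (auto simp: U_def)
        then have "\<not> finer k p' q" using q(2) refines_trans by blast
        then show ?thesis using less.hyps[OF cardU[OF less.prems p'(2,3)] p'(1)] by blast
      qed
      then have "basis p q = ?e p q" by (simp add: exp[OF less.prems] sumU[OF less.prems])
      moreover have "basis p q = 0" using q(2) rf[OF less.prems] by (auto simp: basis_def)
      ultimately show False using q(1) by simp
    qed
  qed
  have diag: "?e p p = 1" if "p \<in> ?P" for p
  proof -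
    have "?e p' p = 0" if "p' \<in> U p - {p}" for p'
      using tri[of p'] that by (auto simp: U_def dest: refines_asym)
    then have "basis p p = ?e p p" by (simp add: exp[OF that] sumU[OF that])
    then show ?thesis by (simp add: basis_def)
  qed
  have "d = c" if d: "is_exclusive_coords k a d" for d
  proof -
    have zero: "(\<Sum>p\<in>?P. (d p - c p) * ?e p q) = 0" for q
    proof -
      have "a q = (\<Sum>p\<in>?P. d p * ?e p q)" "a q = (\<Sum>p\<in>?P. c p * ?e p q)"
        using d ex unfolding is_exclusive_coords_def by metis+
      then show ?thesis by (simp add: left_diff_distrib sum_subtractf)
    qed
    have "d p = c p" if "p \<in> ?P" for p
    proof (rule ccontr)
      assume "d p \<noteq> c p"
      let ?D = "{p \<in> ?P. d p \<noteq> c p}"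
      have D: "finite ?D" "?D \<noteq> {}"
        using finite_partitions that \<open>d p \<noteq> c p\<close> by auto
      define m where "m = arg_min_on (\<lambda>p. - int (card (U p))) ?D"
      have "m \<in> ?D" unfolding m_def by (rule arg_min_if_finite(1)[OF D])
      then have m: "m \<in> ?P" "d m \<noteq> c m" by auto
      have max: "card (U r) \<le> card (U m)" if "r \<in> ?P" "d r \<noteq> c r" for r
        using arg_min_least[OF D, of r "\<lambda>p. - int (card (U p))"] that by (simp add: m_def)
      have off: "(d r - c r) * ?e r m = 0" if "r \<in> ?P - {m}" for r
        using tri[of r] cardU[of r m] max[of r] that by fastforce
      have "(\<Sum>r\<in>?P. (d r - c r) * ?e r m) = (d m - c m) * ?e m m"
        unfolding sum.remove[OF finite_partitions m(1)] using off by (metis (no_types, lifting) add_0_right sum.neutral)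
      then show False using zero[of m] diag[OF m(1)] m(2) by simp
    qed
    moreover have "d p = c p" if "p \<notin> ?P" for p
      using that d ex by (simp add: is_exclusive_coords_def)
    ultimately show "d = c" by blast
  qed
  then show ?thesis using ex by blast
qed

end

theory Submission
  imports Defs
begin

text \<open>
  Closing up the diagram of \<open>p \<circ> \<^sup>tq\<close> folds it onto two rows, so that
  \<open>Tr\<^sub>N (p \<^sup>tq) = N\<^bsup>nc (p \<or> q)\<^esup>\<close>. Hence the moments are linear in the cumulants, with
  matrix entries \<open>N\<^bsup>- \<delta> p q\<^esup>\<close> where
  \<open>\<delta> p q = nc q - nc (q \<or> id) + nc (p \<or> id) - nc (p \<or> q)\<close>. This is nonnegative because the
  lattice of partitions is semimodular, and it vanishes exactly if \<open>q\<close> lies on a geodesic from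
  \<open>id\<close> to \<open>p\<close> for the distance \<open>(nc p + nc q) / 2 - nc (p \<or> q)\<close>. The limit matrix is therefore
  unitriangular with respect to the distance to \<open>id\<close>, and convergence can be transferred in
  both directions. The exclusive cumulants in terms of the cumulants, and the moments in terms of
  the exclusive moments, are given by matrices of the same kind, whose limits are the zeta
  matrices of \<open>\<sqsupset>\<close> and \<open>\<stileturn>\<close>.
\<close>


section \<open>Limits of triangular linear systems\<close>

text \<open>Forward substitution: row \<open>p\<close> of \<open>B\<close> is the unit row minus the
  combination, with coefficients \<open>A p q\<close>, of the rows of smaller height. The induction
  counts the indices of smaller height, a natural number although \<open>h\<close> is integer
  valued.\<close>

lemma triangular_left_inverse:
  fixes A :: "'a \<Rightarrow> 'a \<Rightarrow> complex" and h :: "'a \<Rightarrow> int"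
  assumes fin: "finite S"
    and diag: "\<And>p. p \<in> S \<Longrightarrow> A p p = 1"
    and tri: "\<And>p q. p \<in> S \<Longrightarrow> q \<in> S \<Longrightarrow> A p q \<noteq> 0 \<Longrightarrow> p \<noteq> q \<Longrightarrow> h q < h p"
  obtains B where
    "\<And>p r. p \<in> S \<Longrightarrow> r \<in> S \<Longrightarrow> (\<Sum>q\<in>S. B p q * A q r) = (if p = r then 1 else 0)"
proof -
  have row: "\<exists>b. \<forall>r\<in>S. (\<Sum>q\<in>S. b q * A q r) = (if p = r then 1 else 0)" if "p \<in> S" for p
    using that
  proof (induction "card {q \<in> S. h q < h p}" arbitrary: p rule: less_induct)
    case less
    let ?D = "{q \<in> S. h q < h p}"
    have IH: "\<exists>b. \<forall>r\<in>S. (\<Sum>s\<in>S. b s * A s r) = (if q = r then 1 else 0)" if "q \<in> ?D" for q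
    proof (rule less.hyps)
      have "{s \<in> S. h s < h q} \<subset> ?D" using that by auto
      then show "card {s \<in> S. h s < h q} < card ?D" using fin by (intro psubset_card_mono) auto
    qed (use that in auto)
    then obtain b where b: "\<And>q r. q \<in> ?D \<Longrightarrow> r \<in> S \<Longrightarrow> (\<Sum>s\<in>S. b q s * A s r) = (if q = r then 1 else 0)"
      by metis
    define c where "c s = (if s = p then 1 else 0) - (\<Sum>q\<in>?D. A p q * b q s)" for s
    have "(\<Sum>s\<in>S. c s * A s r) = (if p = r then 1 else 0)" if r: "r \<in> S" for r
    proof -
      have "(\<Sum>s\<in>S. c s * A s r)
          = (\<Sum>s\<in>S. (if s = p then 1 else 0) * A s r) - (\<Sum>s\<in>S. \<Sum>q\<in>?D. A p q * (b q s * A s r))"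
        by (simp add: c_def left_diff_distrib sum_subtractf sum_distrib_right mult.assoc)
      also have "(\<Sum>s\<in>S. (if s = p then 1 else 0) * A s r) = A p r"
        using fin less.prems by (simp add: if_distrib[of "\<lambda>x. x * _"] sum.delta cong: if_cong)
      also have "(\<Sum>s\<in>S. \<Sum>q\<in>?D. A p q * (b q s * A s r)) = (\<Sum>q\<in>?D. A p q * (\<Sum>s\<in>S. b q s * A s r))"
        by (subst sum.swap) (simp add: sum_distrib_left)
      also have "\<dots> = (\<Sum>q\<in>?D. A p q * (if q = r then 1 else 0))"
        using b r by (intro sum.cong) auto
      also have "\<dots> = (if h r < h p then A p r else 0)"
        using fin r by (simp add: if_distrib[of "\<lambda>x. _ * x"] sum.delta cong: if_cong)
      \<comment> \<open>What remains is \<open>A p r\<close> where \<open>h r\<close> is not below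
        \<open>h p\<close>, and \<open>0\<close> elsewhere; triangularity then leaves only the
        diagonal entry.\<close>
      finally show ?thesis
        using tri[OF less.prems r] diag[OF r] by auto
    qed
    then show ?case by blast
  qed
  from bchoice[of S "\<lambda>p b. \<forall>r\<in>S. (\<Sum>q\<in>S. b q * A q r) = (if p = r then 1 else 0)"] row that
  show ?thesis by blast
qed

text \<open>Applying the left inverse \<open>B\<close> of the limit matrix turns the system into
  \<open>x = z - C x\<close> with \<open>z\<close> convergent and \<open>C\<close> tending to
  \<open>0\<close>. This bounds \<open>x\<close>, so that \<open>C x\<close> tends to
  \<open>0\<close> and \<open>x\<close> has the same limit as \<open>z\<close>.\<close>

lemma convergent_of_linear_system:
  fixes A :: "nat \<Rightarrow> 'a \<Rightarrow> 'a \<Rightarrow> complex" and x y :: "nat \<Rightarrow> 'a \<Rightarrow> complex"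
  assumes fin: "finite S"
    and lim: "\<And>p q. p \<in> S \<Longrightarrow> q \<in> S \<Longrightarrow> (\<lambda>N. A N p q) \<longlonglongrightarrow> L p q"
    and inv: "\<And>p r. p \<in> S \<Longrightarrow> r \<in> S \<Longrightarrow> (\<Sum>q\<in>S. B p q * L q r) = (if p = r then 1 else 0)"
    and sys: "\<And>p. p \<in> S \<Longrightarrow> eventually (\<lambda>N. y N p = (\<Sum>q\<in>S. A N p q * x N q)) sequentially"
    and conv: "\<And>p. p \<in> S \<Longrightarrow> convergent (\<lambda>N. y N p)"
    and p: "p \<in> S"
  shows "convergent (\<lambda>N. x N p)"
proof -
  define C where "C N p r = (\<Sum>q\<in>S. B p q * A N q r) - (if p = r then 1 else 0)" for N p r
  define z where "z N p = (\<Sum>q\<in>S. B p q * y N q)" for N p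
  have C0: "(\<lambda>N. C N p r) \<longlonglongrightarrow> 0" if "p \<in> S" "r \<in> S" for p r
  proof -
    have "(\<lambda>N. C N p r) \<longlonglongrightarrow> (\<Sum>q\<in>S. B p q * L q r) - (if p = r then 1 else 0)"
      unfolding C_def using that by (intro tendsto_intros lim)
    then show ?thesis using inv[OF that] by simp
  qed
  have zconv: "convergent (\<lambda>N. z N p)" for p
  proof -
    obtain l where "\<And>q. q \<in> S \<Longrightarrow> (\<lambda>N. y N q) \<longlonglongrightarrow> l q"
      using conv unfolding convergent_def by metis
    then have "(\<lambda>N. z N p) \<longlonglongrightarrow> (\<Sum>q\<in>S. B p q * l q)"
      unfolding z_def by (intro tendsto_intros) auto
    then show ?thesis by (rule convergentI)
  qed
  have "eventually (\<lambda>N. \<forall>q\<in>S. y N q = (\<Sum>r\<in>S. A N q r * x N r)) sequentially"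
    using fin sys by (simp add: eventually_ball_finite)
  then have xz: "eventually (\<lambda>N. \<forall>p\<in>S. x N p = z N p - (\<Sum>r\<in>S. C N p r * x N r)) sequentially"
  proof eventually_elim
    case (elim N)
    show ?case
    proof
      fix p assume p: "p \<in> S"
      have "z N p = (\<Sum>q\<in>S. \<Sum>r\<in>S. B p q * A N q r * x N r)"
        using elim by (simp add: z_def sum_distrib_left mult.assoc)
      also have "\<dots> = (\<Sum>r\<in>S. (\<Sum>q\<in>S. B p q * A N q r) * x N r)"
        by (subst sum.swap) (simp add: sum_distrib_right)
      also have "\<dots> = (\<Sum>r\<in>S. C N p r * x N r + (if p = r then 1 else 0) * x N r)"
        by (simp add: C_def algebra_simps)
      also have "\<dots> = (\<Sum>r\<in>S. C N p r * x N r) + x N p"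
        using fin p by (simp add: sum.distrib if_distrib[of "\<lambda>x. x * _"] sum.delta' cong: if_cong)
      finally show "x N p = z N p - (\<Sum>r\<in>S. C N p r * x N r)" by simp
    qed
  qed
  define c where "c N = (\<Sum>p\<in>S. \<Sum>r\<in>S. cmod (C N p r))" for N
  define X where "X N = (\<Sum>p\<in>S. cmod (x N p))" for N
  define Z where "Z N = (\<Sum>p\<in>S. cmod (z N p))" for N
  have "c \<longlonglongrightarrow> (\<Sum>p\<in>S. \<Sum>r\<in>S. 0)"
    unfolding c_def by (intro tendsto_sum tendsto_norm_zero C0)
  then have "eventually (\<lambda>N. c N < 1 / 2) sequentially"
    by (intro order_tendstoD(2)) auto
  \<comment> \<open>In the sum norm \<open>X \<le> Z + c X\<close>. Once \<open>c < 1 / 2\<close>,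
    the last term is absorbed into the left-hand side.\<close>
  with xz have X_le: "eventually (\<lambda>N. X N \<le> 2 * Z N) sequentially"
  proof eventually_elim
    case (elim N)
    have "X N \<le> (\<Sum>p\<in>S. cmod (z N p) + (\<Sum>r\<in>S. cmod (C N p r) * X N))"
      unfolding X_def
    proof (rule sum_mono)
      fix p assume p: "p \<in> S"
      have "cmod (x N p) \<le> cmod (z N p) + cmod (\<Sum>r\<in>S. C N p r * x N r)"
        using elim p norm_triangle_ineq4 by metis
      also have "cmod (\<Sum>r\<in>S. C N p r * x N r) \<le> (\<Sum>r\<in>S. cmod (C N p r) * cmod (x N r))"
        by (rule order_trans[OF norm_sum]) (simp add: norm_mult)
      also have "\<dots> \<le> (\<Sum>r\<in>S. cmod (C N p r) * (\<Sum>p\<in>S. cmod (x N p)))"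
        using fin by (intro sum_mono mult_left_mono member_le_sum) auto
      finally show "cmod (x N p) \<le> cmod (z N p) + (\<Sum>r\<in>S. cmod (C N p r) * (\<Sum>p\<in>S. cmod (x N p)))"
        by simp
    qed
    also have "\<dots> = Z N + c N * X N"
      by (simp add: Z_def c_def sum.distrib sum_distrib_right)
    also have "c N * X N \<le> 1 / 2 * X N"
      using elim by (intro mult_right_mono) (auto simp: X_def sum_nonneg)
    finally show ?case by simp
  qed
  have "convergent Z"
  proof -
    obtain l where "\<And>q. (\<lambda>N. z N q) \<longlonglongrightarrow> l q"
      using zconv unfolding convergent_def by metis
    then have "Z \<longlonglongrightarrow> (\<Sum>q\<in>S. cmod (l q))"
      unfolding Z_def by (intro tendsto_intros) auto
    then show ?thesis by (rule convergentI)
  qed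
  then obtain K where K: "\<And>N. \<bar>Z N\<bar> \<le> K"
    using convergent_imp_Bseq[of Z] by (metis BseqE real_norm_def)
  \<comment> \<open>Each summand is a bounded sequence times a null sequence.\<close>
  have "(\<lambda>N. \<Sum>r\<in>S. C N p r * x N r) \<longlonglongrightarrow> (\<Sum>r\<in>S. 0)"
  proof (rule tendsto_sum)
    fix r assume r: "r \<in> S"
    have "Bfun (\<lambda>N. x N r) sequentially"
    proof (rule BfunI)
      show "eventually (\<lambda>N. norm (x N r) \<le> 2 * K) sequentially"
        using X_le
      proof eventually_elim
        case (elim N)
        have "norm (x N r) \<le> X N" unfolding X_def using fin r by (intro member_le_sum) auto
        then show ?case using elim K[of N] by linarith
      qed
    qed
    then have "(\<lambda>N. x N r * C N p r) \<longlonglongrightarrow> 0"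
      using C0[OF p r] by (simp add: Bfun_def tendsto_Zfun_iff bounded_bilinear.Bfun_prod_Zfun[OF bounded_bilinear_mult])
    then show "(\<lambda>N. C N p r * x N r) \<longlonglongrightarrow> 0" by (simp add: mult.commute)
  qed
  moreover obtain l where "(\<lambda>N. z N p) \<longlonglongrightarrow> l" using zconv unfolding convergent_def by blast
  ultimately have "(\<lambda>N. z N p - (\<Sum>r\<in>S. C N p r * x N r)) \<longlonglongrightarrow> l - (\<Sum>r\<in>S. 0)"
    by (rule tendsto_diff[rotated])
  moreover have "eventually (\<lambda>N. z N p - (\<Sum>r\<in>S. C N p r * x N r) = x N p) sequentially"
    using xz by eventually_elim (use p in auto)
  ultimately have "(\<lambda>N. x N p) \<longlonglongrightarrow> l - (\<Sum>r\<in>S. 0)"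
    by (rule Lim_transform_eventually)
  then show ?thesis by (rule convergentI)
qed

lemma tendsto_of_nat_powi_nonpos:
  assumes "e \<le> 0"
  shows "(\<lambda>N. of_nat N powi e :: complex) \<longlonglongrightarrow> (if e = 0 then 1 else 0)"
proof (cases "e = 0")
  case False
  define n where "n = nat (- e)"
  have n: "e = - int n" "n > 0" using assms False by (auto simp: n_def)
  have "(\<lambda>N. inverse (of_nat N) ^ n :: complex) \<longlonglongrightarrow> 0 ^ n"
    by (intro tendsto_power tendsto_inverse_0[THEN filterlim_compose] tendsto_of_nat)
  then show ?thesis using n by (simp add: power_int_minus power_inverse zero_power)
qed simp

text \<open>The common form of the three linear relations between moments, cumulants and their
  exclusive versions. With nonpositive exponents, the limit matrix has entry \<open>1\<close> where
  the exponent vanishes and \<open>0\<close> elsewhere, and \<open>h\<close> makes it unitriangular.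
  The system is required for \<open>N \<ge> 1\<close> only, where powers of \<open>N\<close> can be
  cancelled.\<close>

lemma powi_triangular_system:
  fixes x y :: "nat \<Rightarrow> 'a \<Rightarrow> complex" and e :: "'a \<Rightarrow> 'a \<Rightarrow> int" and h :: "'a \<Rightarrow> int"
  assumes fin: "finite S"
    and sys: "\<And>N p. N \<ge> 1 \<Longrightarrow> p \<in> S \<Longrightarrow>
      y N p = (\<Sum>q | q \<in> S \<and> R p q. of_nat N powi e p q * x N q)"
    and refl: "\<And>p. p \<in> S \<Longrightarrow> R p p" "\<And>p. p \<in> S \<Longrightarrow> e p p = 0"
    and le: "\<And>p q. p \<in> S \<Longrightarrow> q \<in> S \<Longrightarrow> R p q \<Longrightarrow> e p q \<le> 0"
    and tri: "\<And>p q. p \<in> S \<Longrightarrow> q \<in> S \<Longrightarrow> R p q \<Longrightarrow> e p q = 0 \<Longrightarrow> p \<noteq> q \<Longrightarrow> h q < h p"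
  shows "(\<forall>p\<in>S. convergent (\<lambda>N. y N p)) \<longleftrightarrow> (\<forall>p\<in>S. convergent (\<lambda>N. x N p))"
    and "\<And>p. \<forall>p\<in>S. convergent (\<lambda>N. x N p) \<Longrightarrow> p \<in> S \<Longrightarrow>
      lim (\<lambda>N. y N p) = (\<Sum>q | q \<in> S \<and> R p q \<and> e p q = 0. lim (\<lambda>N. x N q))"
proof -
  define A :: "nat \<Rightarrow> 'a \<Rightarrow> 'a \<Rightarrow> complex" where "A N p q = (if R p q then of_nat N powi e p q else 0)" for N p q
  define L :: "'a \<Rightarrow> 'a \<Rightarrow> complex" where "L p q = (if R p q \<and> e p q = 0 then 1 else 0)" for p q
  have AL: "(\<lambda>N. A N p q) \<longlonglongrightarrow> L p q" if "p \<in> S" "q \<in> S" for p q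
    using tendsto_of_nat_powi_nonpos[OF le[OF that]] by (cases "R p q") (auto simp: A_def L_def)
  have sysA: "y N p = (\<Sum>q\<in>S. A N p q * x N q)" if "N \<ge> 1" "p \<in> S" for N p
    unfolding sys[OF that] A_def sum.inter_filter[OF fin] by (intro sum.cong) auto
  have ev: "eventually (\<lambda>N. y N p = (\<Sum>q\<in>S. A N p q * x N q)) sequentially" if "p \<in> S" for p
    using eventually_ge_at_top[of 1] by eventually_elim (use sysA that in auto)
  obtain B where B: "\<And>p r. p \<in> S \<Longrightarrow> r \<in> S \<Longrightarrow> (\<Sum>q\<in>S. B p q * L q r) = (if p = r then 1 else 0)"
    using fin by (rule triangular_left_inverse[of S L h]) (use refl tri in \<open>auto simp: L_def split: if_splits\<close>)
  have ylim: "(\<lambda>N. y N p) \<longlonglongrightarrow> (\<Sum>q | q \<in> S \<and> R p q \<and> e p q = 0. lim (\<lambda>N. x N q))"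
    if x: "\<forall>p\<in>S. convergent (\<lambda>N. x N p)" and p: "p \<in> S" for p
  proof -
    have "(\<lambda>N. \<Sum>q\<in>S. A N p q * x N q) \<longlonglongrightarrow> (\<Sum>q\<in>S. L p q * lim (\<lambda>N. x N q))"
      using x p by (intro tendsto_intros AL) (auto simp: convergent_LIMSEQ_iff)
    also have "(\<Sum>q\<in>S. L p q * lim (\<lambda>N. x N q)) = (\<Sum>q | q \<in> S \<and> R p q \<and> e p q = 0. lim (\<lambda>N. x N q))"
      unfolding L_def sum.inter_filter[OF fin] by (intro sum.cong) auto
    finally show ?thesis
      by (rule Lim_transform_eventually) (use ev[OF p] in eventually_elim, simp)
  qed
  show "(\<forall>p\<in>S. convergent (\<lambda>N. y N p)) \<longleftrightarrow> (\<forall>p\<in>S. convergent (\<lambda>N. x N p))"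
    using convergent_of_linear_system[OF fin AL B ev] ylim convergentI by blast
  show "lim (\<lambda>N. y N p) = (\<Sum>q | q \<in> S \<and> R p q \<and> e p q = 0. lim (\<lambda>N. x N q))"
    if "\<forall>p\<in>S. convergent (\<lambda>N. x N p)" "p \<in> S" for p
    using ylim[OF that] by (rule limI)
qed


section \<open>Semimodularity of the lattice of partitions\<close>

lemma partition_on_block_eq:
  assumes "partition_on A P" "B \<in> P" "C \<in> P" "v \<in> B" "v \<in> C"
  shows "B = C"
  using assms partition_onD2[OF assms(1)] unfolding disjoint_def by blast

text \<open>These are the saturated sets of the equivalence relation of \<open>P\<close>. Passing to
  them turns refinement into reverse inclusion and the number of blocks into the binary logarithm of
  a cardinality.\<close>

definition block_unions :: "'a set set \<Rightarrow> 'a set set" where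
  "block_unions P = Union ` Pow P"

lemma finite_block_unions: "finite P \<Longrightarrow> finite (block_unions P)"
  by (simp add: block_unions_def)

lemma mem_block_unions_iff:
  assumes "partition_on A P"
  shows "X \<in> block_unions P \<longleftrightarrow> X \<subseteq> A \<and> (\<forall>B\<in>P. B \<subseteq> X \<or> B \<inter> X = {})"
proof
  assume "X \<in> block_unions P"
  then obtain Q where Q: "X = \<Union>Q" "Q \<subseteq> P" by (auto simp: block_unions_def)
  have "B \<subseteq> X \<or> B \<inter> X = {}" if "B \<in> P" for B
    using Q that partition_onD2[OF assms] unfolding disjoint_def by blast
  then show "X \<subseteq> A \<and> (\<forall>B\<in>P. B \<subseteq> X \<or> B \<inter> X = {})"
    using Q partition_onD1[OF assms] by blast
next
  assume X: "X \<subseteq> A \<and> (\<forall>B\<in>P. B \<subseteq> X \<or> B \<inter> X = {})"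
  then have "X = \<Union>{B \<in> P. B \<subseteq> X}"
    using partition_onD1[OF assms] by blast
  then show "X \<in> block_unions P" unfolding block_unions_def by blast
qed

text \<open>Blocks are nonempty and disjoint, so a set of blocks can be recovered from its
  union.\<close>

lemma card_block_unions:
  assumes "partition_on A P" "finite P"
  shows "card (block_unions P) = 2 ^ card P"
proof -
  have le: "Q \<subseteq> Q'" if "Q \<subseteq> P" "Q' \<subseteq> P" "\<Union>Q = \<Union>Q'" for Q Q'
  proof
    fix B assume B: "B \<in> Q"
    then have BP: "B \<in> P" using that(1) by blast
    then have "B \<noteq> {}" using partition_onD3[OF assms(1)] by blast
    then obtain v where v: "v \<in> B" by blast
    then have "v \<in> \<Union>Q'" using B that(3) by blast
    then obtain B' where B': "B' \<in> Q'" "v \<in> B'" by blast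
    then have "B = B'" using partition_on_block_eq[OF assms(1) BP _ v] that(2) by blast
    then show "B \<in> Q'" using B'(1) by simp
  qed
  have "inj_on Union (Pow P)"
  proof (rule inj_onI)
    fix Q Q' assume "Q \<in> Pow P" "Q' \<in> Pow P" "\<Union>Q = \<Union>Q'"
    then show "Q = Q'" using le[of Q Q'] le[of Q' Q] by simp
  qed
  then show ?thesis using assms(2) by (simp add: block_unions_def card_image card_Pow)
qed

text \<open>A set saturated for the coarser partition is saturated for the finer one. Conversely, a
  block of \<open>Q\<close> is itself in \<open>block_unions Q\<close>, so a block of
  \<open>P\<close> that meets it lies inside it.\<close>

lemma refines_iff_block_unions:
  assumes P: "partition_on A P" and Q: "partition_on A Q"
  shows "refines A P Q \<longleftrightarrow> block_unions Q \<subseteq> block_unions P"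
proof
  assume ref: "refines A P Q"
  show "block_unions Q \<subseteq> block_unions P"
  proof
    fix X assume X: "X \<in> block_unions Q"
    then have XA: "X \<subseteq> A" and XQ: "\<forall>C\<in>Q. C \<subseteq> X \<or> C \<inter> X = {}"
      by (simp_all add: mem_block_unions_iff[OF Q])
    have "B \<subseteq> X \<or> B \<inter> X = {}" if "B \<in> P" for B
    proof -
      have "\<exists>C\<in>Q. B \<subseteq> C" using ref that by (simp add: refines_def)
      then obtain C where C: "C \<in> Q" "B \<subseteq> C" ..
      then have "C \<subseteq> X \<or> C \<inter> X = {}" using XQ by simp
      then show ?thesis using C(2) by blast
    qed
    then show "X \<in> block_unions P" using XA by (simp add: mem_block_unions_iff[OF P])
  qed
next
  assume sub: "block_unions Q \<subseteq> block_unions P"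
  have "\<exists>C\<in>Q. B \<subseteq> C" if B: "B \<in> P" for B
  proof -
    have "B \<noteq> {}" using B partition_onD3[OF P] by blast
    then obtain v where v: "v \<in> B" by blast
    then have "v \<in> \<Union>Q" using B partition_onD1[OF P] partition_onD1[OF Q] by blast
    then obtain C where C: "C \<in> Q" "v \<in> C" by blast
    have "\<Union>{C} \<in> block_unions Q" unfolding block_unions_def using C(1) by (intro imageI) simp
    then have "C \<in> block_unions P" using sub by auto
    then have "B \<subseteq> C \<or> B \<inter> C = {}" using B by (simp add: mem_block_unions_iff[OF P])
    then show ?thesis using v C by blast
  qed
  then show "refines A P Q" using P Q unfolding refines_def by blast
qed

lemma refines_card_le:
  assumes "finite A" "refines A P Q"
  shows "card Q \<le> card P"
proof -
  have P: "partition_on A P" "partition_on A Q" "finite P" "finite Q"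
    using assms by (auto simp: refines_def finite_elements)
  then have "card (block_unions Q) \<le> card (block_unions P)"
    using refines_iff_block_unions[of A P Q] assms by (intro card_mono finite_block_unions) auto
  then show ?thesis using P by (simp add: card_block_unions)
qed

text \<open>The two nested families of unions have the same finite size, hence coincide, and
  refinement holds in both directions.\<close>

lemma refines_card_eq:
  assumes "finite A" "refines A P Q" "card P = card Q"
  shows "P = Q"
proof -
  have P: "partition_on A P" "partition_on A Q" "finite P" "finite Q"
    using assms by (auto simp: refines_def finite_elements)
  have "block_unions Q \<subseteq> block_unions P" using refines_iff_block_unions[OF P(1,2)] assms(2) by simp
  moreover have "card (block_unions Q) = card (block_unions P)"
    using P assms(3) by (simp add: card_block_unions)
  ultimately have "block_unions Q = block_unions P"
    using finite_block_unions[OF P(3)] by (simp add: card_subset_eq)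
  then have "refines A Q P" using refines_iff_block_unions[OF P(2,1)] by simp
  with assms(2) show ?thesis by (rule refines_asym)
qed

lemma sym_diff_in_block_unions:
  assumes "partition_on A P" "X \<in> block_unions P" "Y \<in> block_unions P"
  shows "sym_diff X Y \<in> block_unions P"
proof -
  have "B \<subseteq> sym_diff X Y \<or> B \<inter> sym_diff X Y = {}" if "B \<in> P" for B
  proof -
    have "B \<subseteq> X \<or> B \<inter> X = {}" "B \<subseteq> Y \<or> B \<inter> Y = {}"
      using that assms by (simp_all add: mem_block_unions_iff[OF assms(1)])
    then show ?thesis by blast
  qed
  moreover have "sym_diff X Y \<subseteq> A"
    using assms(2,3) by (auto simp: mem_block_unions_iff[OF assms(1)])
  ultimately show ?thesis by (simp add: mem_block_unions_iff[OF assms(1)])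
qed

lemma partition_on_complementary:
  assumes "X \<subseteq> A"
  shows "partition_on A ({X, A - X} - {{}})"
  using assms by (intro partition_onI) (auto simp: disjnt_def)

text \<open>Partitions into a set and its complement test membership in \<open>block_unions\<close>;
  through them an upper bound of partitions becomes a common element of subspaces. Removing
  \<open>{}\<close> covers the cases \<open>X = {}\<close> and \<open>X = A\<close>.\<close>

lemma refines_complementary_iff:
  assumes P: "partition_on A P" and X: "X \<subseteq> A"
  shows "refines A P ({X, A - X} - {{}}) \<longleftrightarrow> X \<in> block_unions P"
proof -
  have "(\<exists>C\<in>{X, A - X} - {{}}. B \<subseteq> C) \<longleftrightarrow> B \<subseteq> X \<or> B \<inter> X = {}" if "B \<in> P" for B
  proof -
    have "B \<noteq> {}" using that partition_onD3[OF P] by blast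
    moreover have "B \<subseteq> A" unfolding partition_onD1[OF P] using that by (rule Union_upper)
    ultimately show ?thesis by blast
  qed
  then show ?thesis
    using P X partition_on_complementary[OF X] by (simp add: refines_def mem_block_unions_iff[OF P])
qed

text \<open>
  The unions of blocks of a partition form a vector space over the field with two elements, the
  sum being the symmetric difference. Its dimension is the number of blocks, and joins of
  partitions correspond to intersections of subspaces, so that semimodularity becomes the
  dimension formula for the sum of two subspaces.
\<close>

lemma card_join_semimodular:
  assumes fin: "finite A"
    and QP: "refines A Q P" and QP': "refines A Q P'"
    and PJ: "refines A P J"
    and least: "\<And>S. refines A P S \<Longrightarrow> refines A P' S \<Longrightarrow> refines A J S"
  shows "card P + card P' \<le> card Q + card J"
proof -
  have part: "partition_on A P" "partition_on A P'" "partition_on A Q" "partition_on A J"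
    using QP QP' PJ by (auto simp: refines_def)
  then have fins: "finite P" "finite P'" "finite Q" "finite J"
    using fin by (auto intro: finite_elements)
  note finU = fins[THEN finite_block_unions]
  \<comment> \<open>The partition into \<open>X\<close> and its complement is a common upper bound
    of \<open>P\<close> and \<open>P'\<close>, so it is coarser than \<open>J\<close>.\<close>
  have int: "X \<in> block_unions J" if X: "X \<in> block_unions P" "X \<in> block_unions P'" for X
  proof -
    have "X \<subseteq> A" using X by (simp add: mem_block_unions_iff[OF part(1)])
    then show ?thesis
      using X least[of "{X, A - X} - {{}}"] by (simp add: refines_complementary_iff part)
  qed
  define D where "D = block_unions P \<times> block_unions P'"
  \<comment> \<open>The addition map of the two subspaces; the bound follows by counting its domain
    fibre by fibre.\<close>
  define f :: "'a set \<times> 'a set \<Rightarrow> 'a set" where "f d = sym_diff (fst d) (snd d)" for d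
  have finD: "finite D" using finU by (simp add: D_def)
  have sub: "block_unions P \<subseteq> block_unions Q" "block_unions P' \<subseteq> block_unions Q"
    using QP QP' part by (simp_all add: refines_iff_block_unions)
  have img: "f ` D \<subseteq> block_unions Q"
  proof (rule image_subsetI)
    fix d assume "d \<in> D"
    then have "fst d \<in> block_unions Q" "snd d \<in> block_unions Q" using sub by (auto simp: D_def)
    then show "f d \<in> block_unions Q"
      unfolding f_def by (rule sym_diff_in_block_unions[OF part(3)])
  qed
  have fibre: "card {d \<in> D. f d = Z} \<le> card (block_unions J)" for Z
  proof (cases "{d \<in> D. f d = Z} = {}")
    case False
    then obtain d0 where d0: "d0 \<in> D" "f d0 = Z" by blast
    show ?thesis
    \<comment> \<open>Subtracting a fixed point \<open>d0\<close> moves the fibre into the kernel of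
      \<open>f\<close>, whose elements have equal components and hence come from the intersection of
      the two subspaces.\<close>
    proof (rule card_inj_on_le[of "\<lambda>d. sym_diff (fst d0) (fst d)"])
      show "inj_on (\<lambda>d. sym_diff (fst d0) (fst d)) {d \<in> D. f d = Z}"
      proof (rule inj_onI)
        fix c d assume cd: "c \<in> {d \<in> D. f d = Z}" "d \<in> {d \<in> D. f d = Z}"
          and eq: "sym_diff (fst d0) (fst c) = sym_diff (fst d0) (fst d)"
        have fst: "fst c = fst d" using eq by blast
        moreover have "sym_diff (fst c) (snd c) = sym_diff (fst d) (snd d)"
          using cd by (simp add: f_def)
        then have "snd c = snd d" unfolding fst by blast
        ultimately show "c = d" by (rule prod_eqI)
      qed
      show "(\<lambda>d. sym_diff (fst d0) (fst d)) ` {d \<in> D. f d = Z} \<subseteq> block_unions J"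
      proof (rule image_subsetI)
        fix d assume d: "d \<in> {d \<in> D. f d = Z}"
        have "sym_diff (fst d0) (snd d0) = sym_diff (fst d) (snd d)"
          using d d0 by (simp add: f_def)
        then have "sym_diff (fst d0) (fst d) = sym_diff (snd d0) (snd d)" by blast
        moreover have "sym_diff (fst d0) (fst d) \<in> block_unions P"
          using d d0 by (intro sym_diff_in_block_unions[OF part(1)]) (auto simp: D_def)
        moreover have "sym_diff (snd d0) (snd d) \<in> block_unions P'"
          using d d0 by (intro sym_diff_in_block_unions[OF part(2)]) (auto simp: D_def)
        ultimately show "sym_diff (fst d0) (fst d) \<in> block_unions J" by (intro int) simp_all
      qed
    qed (rule finU)
  next
    case True
    then show ?thesis by (metis card.empty le0)
  qed
  have "card D = (\<Sum>Z\<in>f ` D. card {d \<in> D. f d = Z})"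
    unfolding card_eq_sum by (rule sum.image_gen[OF finD])
  also have "\<dots> \<le> card (f ` D) * card (block_unions J)"
    using sum_bounded_above[of "f ` D" "\<lambda>Z. card {d \<in> D. f d = Z}", OF fibre] by simp
  also have "\<dots> \<le> card (block_unions Q) * card (block_unions J)"
    by (intro mult_right_mono card_mono finU img) simp
  finally have "(2::nat) ^ (card P + card P') \<le> 2 ^ (card Q + card J)"
    by (simp add: D_def card_cartesian_product card_block_unions[OF part(1)] part fins
        card_block_unions[OF part(2)] card_block_unions[OF part(3)] card_block_unions[OF part(4)] power_add)
  then show ?thesis by simp
qed

section \<open>Joins of diagrams and the inequalities behind the exponents\<close>

lemma finite_vertices: "finite (vertices k)"
  by (simp add: vertices_def)

lemma finer_refl: "p \<in> partitions k \<Longrightarrow> finer k p p"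
  by (simp add: partitions_def refines_refl)

lemma join_universal:
  assumes "p \<in> partitions k" "q \<in> partitions k"
  shows "finer k p (join k p q)" "finer k q (join k p q)"
    and "finer k p s \<Longrightarrow> finer k q s \<Longrightarrow> finer k (join k p q) s"
  using theI'[OF join_exists1[OF assms]] unfolding join_def by blast+

lemma join_eqI:
  assumes "finer k p r" "finer k q r" "\<And>s. finer k p s \<Longrightarrow> finer k q s \<Longrightarrow> finer k r s"
  shows "join k p q = r"
  unfolding join_def using assms finer_partitions
  by (intro the1_equality join_exists1) blast+

lemma join_absorb: "finer k p q \<Longrightarrow> join k p q = q"
  by (rule join_eqI) (use finer_partitions finer_refl in blast)+

lemma join_absorb2: "finer k p q \<Longrightarrow> join k q p = q"
  by (rule join_eqI) (use finer_partitions finer_refl in blast)+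

lemma nc_join_le:
  assumes p: "p \<in> partitions k" and q: "q \<in> partitions k"
  shows "nc (join k p q) \<le> nc p" "nc (join k p q) \<le> nc q"
  using join_universal(1,2)[OF assms] by (auto intro: refines_card_le[OF finite_vertices])

text \<open>This is \<open>\<delta> p q \<ge> 0\<close>. Semimodularity is applied to
  \<open>p \<or> q\<close> and \<open>q \<or> id\<close>, which are both coarser than
  \<open>q\<close>; their join is coarser than \<open>p \<or> id\<close> and so has at most
  \<open>nc_id k p\<close> blocks.\<close>

lemma nc_join_nc_id:
  assumes p: "p \<in> partitions k" and q: "q \<in> partitions k"
  shows "nc (join k p q) + nc_id k q \<le> nc q + nc_id k p"
proof -
  note id = id_part_in_partitions[of k]
  let ?a = "join k p q" and ?b = "join k q (id_part k)"
  have ab: "?a \<in> partitions k" "?b \<in> partitions k"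
    using p q id by (auto intro: join_in_partitions)
  have "nc ?a + nc ?b \<le> nc q + nc (join k ?a ?b)"
    using join_universal[OF ab] join_universal(2)[OF p q] join_universal(1)[OF q id]
    by (intro card_join_semimodular[OF finite_vertices]) auto
  moreover have "finer k (join k p (id_part k)) (join k ?a ?b)"
  proof (rule join_universal(3)[OF p id])
    show "finer k p (join k ?a ?b)"
      using join_universal(1)[OF p q] join_universal(1)[OF ab] by (rule refines_trans)
    show "finer k (id_part k) (join k ?a ?b)"
      using join_universal(2)[OF q id] join_universal(2)[OF ab] by (rule refines_trans)
  qed
  then have "nc (join k ?a ?b) \<le> nc_id k p"
    unfolding nc_id_def by (rule refines_card_le[OF finite_vertices])
  ultimately show ?thesis by (simp add: nc_id_def)
qed

text \<open>Positivity of the distance between distinct partitions: otherwise both would have as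
  many blocks as their join and so be equal to it. It provides the strict decrease in the
  triangularity of the moment-cumulant system.\<close>

lemma nc_join_less:
  assumes p: "p \<in> partitions k" and q: "q \<in> partitions k" and "p \<noteq> q"
  shows "2 * nc (join k p q) < nc p + nc q"
proof (rule ccontr)
  assume "\<not> ?thesis"
  then have "nc p = nc (join k p q)" "nc q = nc (join k p q)"
    using nc_join_le[OF p q] by linarith+
  then have "p = join k p q" "q = join k p q"
    using join_universal(1,2)[OF p q]
    by (simp_all only: refines_card_eq[OF finite_vertices, of k _ "join k p q"])
  then show False using \<open>p \<noteq> q\<close> by metis
qed

lemma nc_id_antimono:
  assumes "finer k p q"
  shows "nc_id k q \<le> nc_id k p"
proof -
  have "p \<in> partitions k" "q \<in> partitions k" using finer_partitions[OF assms] by auto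
  then have "finer k (join k p (id_part k)) (join k q (id_part k))"
    using assms id_part_in_partitions by (meson join_universal refines_trans)
  then show ?thesis unfolding nc_id_def by (rule refines_card_le[OF finite_vertices])
qed


section \<open>The trace of a product\<close>

lemma card_image_eq_card_image:
  assumes "\<And>x y. x \<in> V \<Longrightarrow> y \<in> V \<Longrightarrow> f x = f y \<longleftrightarrow> g x = g y"
  shows "card (f ` V) = card (g ` V)"
proof -
  have "g (inv_into V f (f x)) = g x" if "x \<in> V" for x
    using that assms by (metis f_inv_into_f image_eqI inv_into_into)
  then have "bij_betw (\<lambda>a. g (inv_into V f a)) (f ` V) (g ` V)"
    using assms by (intro bij_betw_imageI inj_onI) (auto simp: image_image)
  then show ?thesis by (rule bij_betw_same_card)
qed

text \<open>The map \<open>f\<close> on representatives induces a bijection of classes: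
  \<open>iff\<close> makes it well defined and injective, \<open>surj\<close> makes it onto. The
  relations are equivalences on \<open>UNIV\<close> because reflexive transitive closures also
  relate every point outside the diagram to itself.\<close>

lemma card_quotient_eq:
  assumes S: "equiv UNIV S" and T: "equiv UNIV T"
    and f: "f ` V \<subseteq> W"
    and iff: "\<And>x y. x \<in> V \<Longrightarrow> y \<in> V \<Longrightarrow> (x, y) \<in> S \<longleftrightarrow> (f x, f y) \<in> T"
    and surj: "\<And>w. w \<in> W \<Longrightarrow> \<exists>x\<in>V. (f x, w) \<in> T"
  shows "card (V // S) = card (W // T)"
proof -
  have VS: "V // S = (\<lambda>x. S `` {x}) ` V" and WT: "W // T = (\<lambda>x. T `` {x}) ` W"
    by (auto simp: quotient_def)
  have "W // T = (\<lambda>x. T `` {f x}) ` V"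
  proof
    show "W // T \<subseteq> (\<lambda>x. T `` {f x}) ` V"
      unfolding WT using surj equiv_class_eq[OF T] by blast
    show "(\<lambda>x. T `` {f x}) ` V \<subseteq> W // T" unfolding WT using f by blast
  qed
  moreover have "S `` {x} = S `` {y} \<longleftrightarrow> T `` {f x} = T `` {f y}" if "x \<in> V" "y \<in> V" for x y
    using iff[OF that] eq_equiv_class_iff[OF S] eq_equiv_class_iff[OF T] by simp
  then have "card ((\<lambda>x. S `` {x}) ` V) = card ((\<lambda>x. T `` {f x}) ` V)"
    by (rule card_image_eq_card_image)
  ultimately show ?thesis by (simp add: VS)
qed

definition same_block :: "'a set set \<Rightarrow> ('a \<times> 'a) set" where
  "same_block P = (\<Union>B\<in>P. B \<times> B)"

lemma sym_same_block: "sym (same_block P)"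
  by (auto simp: same_block_def sym_def)

lemma equiv_rtrancl: "sym R \<Longrightarrow> equiv UNIV (R\<^sup>*)"
  by (intro equivI refl_rtrancl sym_rtrancl trans_rtrancl) auto

text \<open>Describes the join by connected components of a graph, the form in which it can be
  compared with stacked diagrams.\<close>

lemma join_eq_quotient:
  assumes p: "p \<in> partitions k" and q: "q \<in> partitions k"
  shows "join k p q = vertices k // (same_block p \<union> same_block q)\<^sup>*"
proof -
  let ?V = "vertices k" and ?R = "same_block p \<union> same_block q"
  let ?J = "?V // ?R\<^sup>*"
  have pp: "partition_on ?V p" "partition_on ?V q" using p q by (auto simp: partitions_def)
  have RV: "?R \<subseteq> ?V \<times> ?V"
    using partition_onD1[OF pp(1)] partition_onD1[OF pp(2)] by (auto simp: same_block_def)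
  have E: "equiv UNIV (?R\<^sup>*)" by (intro equiv_rtrancl sym_Un sym_same_block)
  have closed: "y \<in> ?V" if "(x, y) \<in> ?R\<^sup>*" "x \<in> ?V" for x y
    using that by (induction rule: rtrancl_induct) (use RV in blast)+
  have J: "partition_on ?V ?J"
  proof (rule partition_onI)
    show "\<Union>?J = ?V" unfolding quotient_def using closed by auto
    show "disjnt X Y" if "X \<in> ?J" "Y \<in> ?J" "X \<noteq> Y" for X Y
    proof -
      have "X \<in> UNIV // ?R\<^sup>*" "Y \<in> UNIV // ?R\<^sup>*" using that by (auto simp: quotient_def)
      then show ?thesis using quotient_disj[OF E] that by (auto simp: disjnt_def)
    qed
    show "{} \<notin> ?J" by (auto simp: quotient_def)
  qed
  have up: "finer k r ?J" if "partition_on ?V r" "same_block r \<subseteq> ?R" for r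
  proof -
    have "\<exists>Y\<in>?J. B \<subseteq> Y" if B: "B \<in> r" for B
    proof -
      have "B \<noteq> {}" using B partition_onD3[OF \<open>partition_on ?V r\<close>] by blast
      then obtain v where v: "v \<in> B" by blast
      then have "v \<in> ?V" using B partition_onD1[OF \<open>partition_on ?V r\<close>] by blast
      then have "?R\<^sup>* `` {v} \<in> ?J" by (rule quotientI)
      moreover have "(v, w) \<in> same_block r" if "w \<in> B" for w
        using B v that by (auto simp: same_block_def)
      then have "B \<subseteq> ?R\<^sup>* `` {v}" using \<open>same_block r \<subseteq> ?R\<close> by blast
      ultimately show ?thesis by (rule bexI[rotated])
    qed
    then show ?thesis using J \<open>partition_on ?V r\<close> by (auto simp: refines_def)
  qed
  show ?thesis
  proof (rule join_eqI)
    show "finer k p ?J" "finer k q ?J" using pp by (auto intro: up)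
    fix s assume s: "finer k p s" "finer k q s"
    then have ps: "partition_on ?V s" by (auto simp: refines_def)
    \<comment> \<open>Blocks of a common upper bound are closed under the edges of both partitions,
      so a path never leaves its block.\<close>
    have "?R\<^sup>* `` {x} \<subseteq> C" if "x \<in> C" "C \<in> s" for x C
    proof -
      have "y \<in> C" if "(x, y) \<in> ?R\<^sup>*" for y
        using that
      proof (induction rule: rtrancl_induct)
        case (step y z)
        then obtain B where B: "B \<in> p \<or> B \<in> q" "y \<in> B" "z \<in> B" by (auto simp: same_block_def)
        then have "\<exists>D\<in>s. B \<subseteq> D" using s by (auto simp: refines_def)
        then obtain D where D: "D \<in> s" "B \<subseteq> D" ..
        then have "C = D" using partition_on_block_eq[OF ps \<open>C \<in> s\<close>, of D y] step.IH B by blast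
        then show ?case using B D by blast
      qed (fact \<open>x \<in> C\<close>)
      then show ?thesis by blast
    qed
    moreover have "\<exists>C\<in>s. x \<in> C" if "x \<in> ?V" for x
      using that partition_onD1[OF ps] by blast
    ultimately have "\<exists>C\<in>s. X \<subseteq> C" if "X \<in> ?J" for X
      using that by (metis quotientE)
    then show "finer k ?J s" using J ps by (auto simp: refines_def)
  qed
qed

text \<open>A left inverse of \<open>place_below\<close>. On the upper diagram it undoes
  \<open>place_above\<close> up to \<open>flip\<close>, which cancels the transposition of
  \<open>q\<close>.\<close>

fun fold_stacked :: "stacked_vertex \<Rightarrow> vertex" where
  "fold_stacked (Upper i) = Bot i"
| "fold_stacked (Middle i) = Top i"
| "fold_stacked (Lower i) = Bot i"

text \<open>The strands that close a stacked diagram when its trace is taken; both orientations are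
  included to keep the relation symmetric.\<close>

definition closing_edges :: "nat \<Rightarrow> (stacked_vertex \<times> stacked_vertex) set" where
  "closing_edges k = (\<Union>i\<in>{1..k}. {(Upper i, Lower i), (Lower i, Upper i)})"

lemma flip_flip [simp]: "flip (flip v) = v"
  by (cases v) auto

lemma fold_place_below [simp]: "fold_stacked (place_below v) = v"
  by (cases v) auto

lemma fold_place_above [simp]: "fold_stacked (place_above v) = flip v"
  by (cases v) auto

lemma sym_stacked_edges: "sym (stacked_edges p q)"
  by (auto simp: stacked_edges_def sym_def)

lemma sym_closing_edges: "sym (closing_edges k)"
  by (auto simp: closing_edges_def sym_def)

lemma fold_stacked_edge:
  assumes "(y, z) \<in> stacked_edges p (transpose_part q)"
  shows "(fold_stacked y, fold_stacked z) \<in> same_block p \<union> same_block q"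
proof -
  consider B where "B \<in> q" "y \<in> place_above ` flip ` B" "z \<in> place_above ` flip ` B"
    | B where "B \<in> p" "y \<in> place_below ` B" "z \<in> place_below ` B"
    using assms unfolding stacked_edges_def transpose_part_def by blast
  then show ?thesis
  proof cases
    case (1 B)
    then have "fold_stacked y \<in> B" "fold_stacked z \<in> B" by auto
    then show ?thesis using 1(1) by (auto simp: same_block_def)
  next
    case (2 B)
    then have "fold_stacked y \<in> B" "fold_stacked z \<in> B" by auto
    then show ?thesis using 2(1) by (auto simp: same_block_def)
  qed
qed

text \<open>
  The closure of the diagram of \<open>p\<close> below \<open>\<^sup>tq\<close>: identifying the outer rows folds it onto the two
  rows of \<open>p\<close> and \<open>q\<close>.
\<close>

lemma nc_join_eq_closed_components:
  assumes p: "p \<in> partitions k" and q: "q \<in> partitions k"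
  shows "nc (join k p q)
    = card (stacked_vertices k // (stacked_edges p (transpose_part q) \<union> closing_edges k)\<^sup>*)"
proof -
  let ?G = "stacked_edges p (transpose_part q) \<union> closing_edges k" and ?R = "same_block p \<union> same_block q"
  have subV: "v \<in> vertices k" if "v \<in> B" "B \<in> p \<union> q" for v B
    using that p q by (auto simp: partitions_def partition_on_def)
  have G: "equiv UNIV (?G\<^sup>*)"
    by (intro equiv_rtrancl sym_Un sym_stacked_edges sym_closing_edges)
  \<comment> \<open>The copies of \<open>v\<close> in the two diagrams coincide in the middle row if
    \<open>v\<close> is a \<open>Top\<close> vertex, and are joined by a closing edge if it is a
    \<open>Bot\<close> vertex.\<close>
  have above: "(place_below v, place_above (flip v)) \<in> ?G\<^sup>*" "(place_above (flip v), place_below v) \<in> ?G\<^sup>*"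
    if "v \<in> vertices k" for v
    using that by (cases v; force simp: vertices_def closing_edges_def)+
  have fwd: "(place_below x, place_below y) \<in> ?G\<^sup>*" if "(x, y) \<in> ?R\<^sup>*" for x y
    using that
  proof (induction rule: rtrancl_induct)
    case (step y z)
    \<comment> \<open>An edge of \<open>p\<close> is drawn directly in the lower diagram. An edge of
      \<open>q\<close> is followed by passing to the upper copy, crossing there and coming
      back.\<close>
    have "(place_below y, place_below z) \<in> ?G\<^sup>*"
    proof (cases "(y, z) \<in> same_block p")
      case True
      then show ?thesis by (auto simp: same_block_def stacked_edges_def intro!: r_into_rtrancl)
    next
      case False
      then obtain B where B: "B \<in> q" "y \<in> B" "z \<in> B" using step by (auto simp: same_block_def)
      then have "flip ` B \<in> transpose_part q" "place_above (flip y) \<in> place_above ` flip ` B"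
          "place_above (flip z) \<in> place_above ` flip ` B"
        by (auto simp: transpose_part_def)
      then have "(place_above (flip y), place_above (flip z)) \<in> stacked_edges p (transpose_part q)"
        unfolding stacked_edges_def by (intro UnI1 UN_I SigmaI)
      then have "(place_above (flip y), place_above (flip z)) \<in> ?G\<^sup>*" by blast
      moreover have "y \<in> vertices k" "z \<in> vertices k" using subV B by blast+
      ultimately show ?thesis using above by (meson rtrancl_trans)
    qed
    with step.IH show ?case by (rule rtrancl_trans)
  qed simp
  have bwd: "(fold_stacked x, fold_stacked y) \<in> ?R\<^sup>*" if "(x, y) \<in> ?G\<^sup>*" for x y
    using that
  proof (induction rule: rtrancl_induct)
    case (step y z)
    have "(fold_stacked y, fold_stacked z) \<in> ?R\<^sup>*"
    proof (cases "(y, z) \<in> closing_edges k")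
      case True
      then have "fold_stacked y = fold_stacked z" by (auto simp: closing_edges_def)
      then show ?thesis by simp
    next
      case False
      then show ?thesis using step(2) fold_stacked_edge by blast
    qed
    with step.IH show ?case by (rule rtrancl_trans)
  qed simp
  have "card (vertices k // ?R\<^sup>*) = card (stacked_vertices k // ?G\<^sup>*)"
  proof (rule card_quotient_eq[where f = place_below])
    show "equiv UNIV (?R\<^sup>*)" by (intro equiv_rtrancl sym_Un sym_same_block)
    show "place_below ` vertices k \<subseteq> stacked_vertices k"
      by (auto simp: vertices_def stacked_vertices_def)
    show "(x, y) \<in> ?R\<^sup>* \<longleftrightarrow> (place_below x, place_below y) \<in> ?G\<^sup>*" for x y
      using fwd[of x y] bwd[of "place_below x" "place_below y"] by auto
    fix w assume "w \<in> stacked_vertices k"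
    then have "fold_stacked w \<in> vertices k" "(place_below (fold_stacked w), w) \<in> ?G\<^sup>*"
      by (cases w; force simp: vertices_def stacked_vertices_def closing_edges_def)+
    then show "\<exists>x\<in>vertices k. (place_below x, w) \<in> ?G\<^sup>*" by blast
  qed (rule G)
  then show ?thesis using join_eq_quotient[OF p q] by simp
qed

text \<open>Discarding \<open>{}\<close> in \<open>compose_part\<close> only loses components
  without outer vertices, so connectivity between outer vertices is fully recorded.\<close>

lemma outer_in_component_iff:
  assumes "x \<in> vertices k" "y \<in> vertices k"
  shows "(x, y) \<in> same_block (compose_part k p q) \<longleftrightarrow> (outer x, outer y) \<in> (stacked_edges p q)\<^sup>*"
proof
  assume "(x, y) \<in> same_block (compose_part k p q)"
  then obtain C where C: "C \<in> components k p q" "outer x \<in> C" "outer y \<in> C"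
    by (auto simp: same_block_def compose_part_def)
  then have "C \<in> UNIV // (stacked_edges p q)\<^sup>*" by (auto simp: components_def quotient_def)
  then show "(outer x, outer y) \<in> (stacked_edges p q)\<^sup>*"
    using C in_quotient_imp_in_rel[OF equiv_rtrancl[OF sym_stacked_edges]] by blast
next
  assume xy: "(outer x, outer y) \<in> (stacked_edges p q)\<^sup>*"
  let ?C = "(stacked_edges p q)\<^sup>* `` {outer x}"
  have "outer x \<in> stacked_vertices k"
    using assms by (auto simp: vertices_def stacked_vertices_def)
  then have "?C \<in> components k p q" by (auto simp: components_def quotient_def)
  moreover have "x \<in> outer -` ?C" "y \<in> outer -` ?C" using xy by auto
  ultimately show "(x, y) \<in> same_block (compose_part k p q)"
    unfolding same_block_def compose_part_def by blast
qed

text \<open>A component of the closed diagram inside the middle row meets no closing edge and is a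
  loop of the composition. Every other component meets the outer rows, where the closing edges act
  as the blocks of \<open>id_part\<close>, so these components are counted by the join of the
  composition with the identity.\<close>

lemma closed_components_eq_loops_nc_id:
  assumes p: "p \<in> partitions k" and q: "q \<in> partitions k"
  shows "card (stacked_vertices k // (stacked_edges p q \<union> closing_edges k)\<^sup>*)
    = loops k p q + nc_id k (compose_part k p q)"
proof -
  let ?E = "stacked_edges p q" and ?W = "stacked_vertices k" and ?M = "Middle ` {1..k}"
  let ?G = "?E \<union> closing_edges k" and ?V = "vertices k"
  let ?c = "compose_part k p q"
  let ?R = "same_block ?c \<union> same_block (id_part k)"
  have c: "?c \<in> partitions k" using p q by (rule compose_part_in_partitions)
  have G: "equiv UNIV (?G\<^sup>*)" and E: "equiv UNIV (?E\<^sup>*)"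
    by (intro equiv_rtrancl sym_Un sym_stacked_edges sym_closing_edges)+
  have EG: "?E\<^sup>* \<subseteq> ?G\<^sup>*" by (intro rtrancl_mono) auto
  have outV: "outer x \<in> ?W" if "x \<in> ?V" for x
    using that by (auto simp: vertices_def stacked_vertices_def)
  have fwd: "(outer x, outer y) \<in> ?G\<^sup>*" if "(x, y) \<in> ?R\<^sup>*" "x \<in> ?V" for x y
  proof -
    have "y \<in> ?V \<and> (outer x, outer y) \<in> ?G\<^sup>*"
      using that
    proof (induction rule: rtrancl_induct)
      case (step y z)
      have z: "z \<in> ?V"
        using step c id_part_in_partitions[of k]
        by (auto simp: same_block_def partitions_def partition_on_def)
      have "(outer y, outer z) \<in> ?G\<^sup>*"
      proof (cases "(y, z) \<in> same_block ?c")
        case True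
        then show ?thesis using outer_in_component_iff[of y k z p q] step z EG by blast
      next
        case False
        then have "(outer y, outer z) \<in> (closing_edges k)\<^sup>="
          using step by (auto simp: same_block_def id_part_def closing_edges_def)
        then show ?thesis by auto
      qed
      then show ?case using step z by auto
    qed simp
    then show ?thesis by simp
  qed
  \<comment> \<open>Invariant along a path of the closed diagram: \<open>z\<close> is an outer
    vertex from which the current point is reached by stacked edges alone. A closing edge resets
    \<open>z\<close> to its endpoint.\<close>
  have path: "\<exists>z\<in>?V. (x, z) \<in> ?R\<^sup>* \<and> (outer z, w) \<in> ?E\<^sup>*" if "(outer x, w) \<in> ?G\<^sup>*" "x \<in> ?V" for x w
    using that
  proof (induction rule: rtrancl_induct)
    case base
    then show ?case by blast
  next
    case (step w w')
    then obtain z where z: "z \<in> ?V" "(x, z) \<in> ?R\<^sup>*" "(outer z, w) \<in> ?E\<^sup>*" by blast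
    show ?case
    proof (cases "(w, w') \<in> ?E")
      case True
      then show ?thesis using z by (meson rtrancl.rtrancl_into_rtrancl)
    next
      case False
      then have "(w, w') \<in> closing_edges k" using step by blast
      then obtain v v' where v: "w = outer v" "w' = outer v'" "v \<in> ?V" "v' \<in> ?V"
          "(v, v') \<in> same_block (id_part k)"
        by (force simp: closing_edges_def same_block_def id_part_def vertices_def
            intro: outer.simps[symmetric])
      have "(z, v) \<in> same_block ?c" using outer_in_component_iff z v by blast
      then have "(x, v') \<in> ?R\<^sup>*" using z(2) v(5) by (meson UnI1 UnI2 rtrancl.rtrancl_into_rtrancl)
      then show ?thesis using v by blast
    qed
  qed
  have bwd: "(x, y) \<in> ?R\<^sup>*" if xy: "(outer x, outer y) \<in> ?G\<^sup>*" "x \<in> ?V" "y \<in> ?V" for x y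
  proof -
    obtain z where z: "z \<in> ?V" "(x, z) \<in> ?R\<^sup>*" "(outer z, outer y) \<in> ?E\<^sup>*"
      using path[OF xy(1,2)] by blast
    then have "(z, y) \<in> same_block ?c" using outer_in_component_iff xy by blast
    then show ?thesis using z(2) by (meson UnI1 rtrancl.rtrancl_into_rtrancl)
  qed
  have nc: "nc_id k ?c = card (outer ` ?V // ?G\<^sup>*)"
    unfolding nc_id_def join_eq_quotient[OF c id_part_in_partitions]
  proof (rule card_quotient_eq[where f = outer])
    show "equiv UNIV (?R\<^sup>*)" by (intro equiv_rtrancl sym_Un sym_same_block)
  qed (use G fwd bwd in auto)
  \<comment> \<open>Closing edges start in the outer rows only, so a path confined to the middle row
    uses stacked edges throughout.\<close>
  have step_outer: "(w, w') \<in> ?E" if "(w, w') \<in> ?G" "w \<in> ?M" for w w'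
    using that by (auto simp: closing_edges_def)
  have stay: "(w, w') \<in> ?E\<^sup>*" if "(w, w') \<in> ?G\<^sup>*" "?E\<^sup>* `` {w} \<subseteq> ?M" for w w'
    using that(1)
  proof (induction rule: rtrancl_induct)
    case (step y z)
    then have "y \<in> ?M" using that(2) by blast
    then show ?case using step step_outer by (meson rtrancl.rtrancl_into_rtrancl)
  qed simp
  have same: "?E\<^sup>* `` {w} = ?G\<^sup>* `` {w}" if "?E\<^sup>* `` {w} \<subseteq> ?M" for w
    using stay[OF _ that] EG by blast
  have loops: "{C \<in> components k p q. C \<subseteq> ?M} = {C \<in> ?W // ?G\<^sup>*. C \<subseteq> ?M}"
  proof (intro equalityI subsetI)
    fix C assume "C \<in> {C \<in> components k p q. C \<subseteq> ?M}"
    then show "C \<in> {C \<in> ?W // ?G\<^sup>*. C \<subseteq> ?M}"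
      unfolding components_def quotient_def using same by auto
  next
    fix C assume "C \<in> {C \<in> ?W // ?G\<^sup>*. C \<subseteq> ?M}"
    then obtain w where w: "w \<in> ?W" "C = ?G\<^sup>* `` {w}" "C \<subseteq> ?M" by (auto simp: quotient_def)
    then have "?E\<^sup>* `` {w} \<subseteq> ?M" using EG by blast
    then show "C \<in> {C \<in> components k p q. C \<subseteq> ?M}"
      using w same unfolding components_def quotient_def by auto
  qed
  have W: "?W = outer ` ?V \<union> ?M"
    by (force simp: vertices_def stacked_vertices_def image_Un image_image)
  have disj: "outer ` ?V \<inter> ?M = {}" by (auto simp: vertices_def)
  have GW: "?G \<subseteq> ?W \<times> ?W"
  proof -
    have "v \<in> vertices k" if "v \<in> B" "B \<in> p \<union> q" for v B
      using that p q by (auto simp: partitions_def partition_on_def)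
    moreover have "place_above v \<in> ?W" "place_below v \<in> ?W" if "v \<in> vertices k" for v
      using that by (auto simp: vertices_def stacked_vertices_def)
    ultimately have "stacked_edges p q \<subseteq> ?W \<times> ?W"
      unfolding stacked_edges_def by blast
    moreover have "closing_edges k \<subseteq> ?W \<times> ?W"
      by (auto simp: closing_edges_def stacked_vertices_def)
    ultimately show ?thesis by (rule Un_least)
  qed
  have closed: "w' \<in> ?W" if "(w, w') \<in> ?G\<^sup>*" "w \<in> ?W" for w w'
    using that by (induction rule: rtrancl_induct) (use GW in blast)+
  have split: "?W // ?G\<^sup>* = {C \<in> ?W // ?G\<^sup>*. C \<subseteq> ?M} \<union> (outer ` ?V // ?G\<^sup>*)"
  proof (intro equalityI subsetI)
    fix C assume "C \<in> ?W // ?G\<^sup>*"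
    then obtain w where w: "w \<in> ?W" "C = ?G\<^sup>* `` {w}" by (auto simp: quotient_def)
    show "C \<in> {C \<in> ?W // ?G\<^sup>*. C \<subseteq> ?M} \<union> (outer ` ?V // ?G\<^sup>*)"
    proof (cases "C \<subseteq> ?M")
      case False
      then obtain w' where w': "w' \<in> outer ` ?V" "(w, w') \<in> ?G\<^sup>*" using w closed W by blast
      then have "C = ?G\<^sup>* `` {w'}" using w equiv_class_eq[OF G] by blast
      then show ?thesis using w' unfolding quotient_def by blast
    qed (use \<open>C \<in> ?W // ?G\<^sup>*\<close> in blast)
  next
    fix C assume "C \<in> {C \<in> ?W // ?G\<^sup>*. C \<subseteq> ?M} \<union> (outer ` ?V // ?G\<^sup>*)"
    then show "C \<in> ?W // ?G\<^sup>*" using W unfolding quotient_def by blast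
  qed
  have loops_eq: "loops k p q = card {C \<in> ?W // ?G\<^sup>*. C \<subseteq> ?M}"
    unfolding loops_def loops ..
  have "{C \<in> ?W // ?G\<^sup>*. C \<subseteq> ?M} \<inter> (outer ` ?V // ?G\<^sup>*) = {}"
    using disj unfolding quotient_def by blast
  moreover have "finite (?W // ?G\<^sup>*)" by (simp add: quotient_def stacked_vertices_def)
  then have "finite {C \<in> ?W // ?G\<^sup>*. C \<subseteq> ?M}" "finite (outer ` ?V // ?G\<^sup>*)"
    by (auto simp: quotient_def finite_vertices)
  ultimately have "card ({C \<in> ?W // ?G\<^sup>*. C \<subseteq> ?M} \<union> (outer ` ?V // ?G\<^sup>*))
      = loops k p q + nc_id k ?c"
    unfolding loops_eq nc by (intro card_Un_disjoint)
  then show ?thesis using split by simp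
qed

text \<open>The left-hand side is the exponent of \<open>N\<close> in the trace of \<open>p\<close>
  times the transpose of \<open>q\<close>: the loops come from the product, the other term from
  \<open>Tr\<close>.\<close>

lemma loops_plus_nc_id_transpose:
  assumes "p \<in> partitions k" "q \<in> partitions k"
  shows "loops k p (transpose_part q) + nc_id k (compose_part k p (transpose_part q)) = nc (join k p q)"
  using nc_join_eq_closed_components[OF assms]
    closed_components_eq_loops_nc_id[OF assms(1) transpose_part_in_partitions[OF assms(2)]] by simp


section \<open>Linear relations between moments and cumulants\<close>

text \<open>The bilinear form sending \<open>a\<close> and \<open>c\<close> to the trace of
  \<open>a\<close> times the transpose of \<open>c\<close>, written without composition: its Gram
  matrix on diagrams is \<open>N ^ nc (join k p q)\<close>.\<close>

definition pairing :: "nat \<Rightarrow> nat \<Rightarrow> element \<Rightarrow> element \<Rightarrow> complex" where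
  "pairing k N a c = (\<Sum>p\<in>partitions k. \<Sum>q\<in>partitions k. a p * c q * of_nat N ^ nc (join k p q))"

lemma sum_mult_basis:
  assumes "p \<in> partitions k"
  shows "(\<Sum>q\<in>partitions k. basis p q * g q) = g p"
  using assms finite_partitions
  by (simp add: basis_def if_distrib[of "\<lambda>x. x * _"] sum.delta cong: if_cong)

lemma Tr_basis: "p \<in> partitions k \<Longrightarrow> Tr k N (basis p) = of_nat N ^ nc_id k p"
  unfolding Tr_def by (rule sum_mult_basis)

lemma Tr_mult:
  "Tr k N (mult k N a b) = (\<Sum>p\<in>partitions k. \<Sum>q\<in>partitions k.
     a p * b q * of_nat N ^ (loops k p q + nc_id k (compose_part k p q)))"
proof -
  let ?P = "partitions k"
  have "Tr k N (mult k N a b) = (\<Sum>r\<in>?P. \<Sum>p\<in>?P. \<Sum>q\<in>?P.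
      a p * b q * of_nat N ^ loops k p q * (basis (compose_part k p q) r * of_nat N ^ nc_id k r))"
    by (simp add: Tr_def mult_def sum_distrib_right mult.assoc)
  also have "\<dots> = (\<Sum>p\<in>?P. \<Sum>q\<in>?P. \<Sum>r\<in>?P.
      a p * b q * of_nat N ^ loops k p q * (basis (compose_part k p q) r * of_nat N ^ nc_id k r))"
    by (subst sum.swap) (intro sum.cong refl sum.swap)
  also have "\<dots> = (\<Sum>p\<in>?P. \<Sum>q\<in>?P.
     a p * b q * of_nat N ^ (loops k p q + nc_id k (compose_part k p q)))"
    by (intro sum.cong refl)
      (simp add: sum_distrib_left[symmetric] sum_mult_basis compose_part_in_partitions power_add mult.assoc)
  finally show ?thesis .
qed

lemma Tr_mult_transp: "Tr k N (mult k N a (transp k c)) = pairing k N a c"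
proof -
  let ?P = "partitions k"
  let ?t = "\<lambda>p q. of_nat N ^ (loops k p q + nc_id k (compose_part k p q)) :: complex"
  have "(\<Sum>q\<in>?P. a p * transp k c q * ?t p q) = (\<Sum>q\<in>?P. a p * c q * of_nat N ^ nc (join k p q))"
    if p: "p \<in> ?P" for p
  proof -
    have "(\<Sum>q\<in>?P. a p * transp k c q * ?t p q)
        = (\<Sum>q\<in>?P. \<Sum>r\<in>?P. a p * c r * (basis (transpose_part r) q * ?t p q))"
      by (simp add: transp_def sum_distrib_left sum_distrib_right mult.assoc)
    also have "\<dots> = (\<Sum>r\<in>?P. \<Sum>q\<in>?P. a p * c r * (basis (transpose_part r) q * ?t p q))"
      by (rule sum.swap)
    also have "\<dots> = (\<Sum>r\<in>?P. a p * c r * ?t p (transpose_part r))"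
      by (intro sum.cong refl)
        (simp add: sum_distrib_left[symmetric] sum_mult_basis transpose_part_in_partitions)
    also have "\<dots> = (\<Sum>r\<in>?P. a p * c r * of_nat N ^ nc (join k p r))"
      using p by (intro sum.cong refl) (simp add: loops_plus_nc_id_transpose)
    finally show ?thesis .
  qed
  then show ?thesis unfolding Tr_mult pairing_def by (rule sum.cong[OF refl])
qed

text \<open>The exponent is \<open>- \<delta> p q\<close>. It collects the power of \<open>N\<close>
  from the pairing, the division by the trace of \<open>p\<close>, and the normalization of the
  cumulant of \<open>q\<close>, which has to be undone.\<close>

lemma moment_eq_sum_cumulant:
  assumes N: "N \<ge> 1" and p: "p \<in> partitions k"
  shows "moment k N p a = (\<Sum>q\<in>partitions k.
    of_nat N powi (int (nc (join k p q)) + int (nc_id k q) - int (nc q) - int (nc_id k p)) * cumulant k N q a)"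
proof -
  have N0: "of_nat N \<noteq> (0::complex)" using N by simp
  have "moment k N p a = (\<Sum>q\<in>partitions k. a q * of_nat N ^ nc (join k q p)) / of_nat N ^ nc_id k p"
    using p unfolding moment_def Tr_mult_transp Tr_basis[OF p] pairing_def
    by (simp add: sum_mult_basis mult.assoc sum_distrib_left[symmetric])
  also have "\<dots> = (\<Sum>q\<in>partitions k. of_nat N powi
      (int (nc (join k p q)) + int (nc_id k q) - int (nc q) - int (nc_id k p)) * cumulant k N q a)"
    unfolding sum_divide_distrib
  proof (rule sum.cong)
    fix q assume "q \<in> partitions k"
    have "join k q p = join k p q" unfolding join_def by (metis (full_types))
    moreover have "of_nat N powi (int (nc (join k p q)) + int (nc_id k q) - int (nc q) - int (nc_id k p))
        * of_nat N powi (int (nc q) - int (nc_id k q))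
        = (of_nat N powi (int (nc (join k p q)) - int (nc_id k p)) :: complex)"
      using N0 by (subst power_int_add[symmetric]) (simp_all add: algebra_simps)
    then have "of_nat N powi (int (nc (join k p q)) + int (nc_id k q) - int (nc q) - int (nc_id k p))
        * of_nat N powi (int (nc q) - int (nc_id k q))
        = (of_nat N ^ nc (join k p q) / of_nat N ^ nc_id k p :: complex)"
      unfolding power_int_diff[OF disjI1[OF N0]] by (simp only: power_int_of_nat)
    ultimately show "a q * of_nat N ^ nc (join k q p) / of_nat N ^ nc_id k p = of_nat N powi
      (int (nc (join k p q)) + int (nc_id k q) - int (nc q) - int (nc_id k p)) * cumulant k N q a"
      unfolding cumulant_def by (metis mult.assoc mult.commute times_divide_eq_left)
  qed simp
  finally show ?thesis .
qed

text \<open>The pairing is linear in its second argument, where the diagram \<open>p\<close> is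
  expanded in the exclusive basis. The power of \<open>N\<close> accounts for normalizing by the
  trace of \<open>q\<close> in place of that of \<open>p\<close>.\<close>

lemma moment_eq_sum_exclusive_moment:
  assumes N: "N \<ge> 1" and p: "p \<in> partitions k"
  shows "moment k N p a = (\<Sum>q | q \<in> partitions k \<and> finer k p q.
    of_nat N powi (int (nc_id k q) - int (nc_id k p)) * exclusive_moment k N q a)"
proof -
  have N0: "of_nat N \<noteq> (0::complex)" using N by simp
  let ?U = "{q. q \<in> partitions k \<and> finer k p q}"
  have "pairing k N a (basis p) = (\<Sum>p1\<in>partitions k. \<Sum>q\<in>partitions k. \<Sum>r\<in>?U.
      a p1 * exclusive k r q * of_nat N ^ nc (join k p1 q))"
    using exclusive_family_basis[OF is_exclusive_family_exclusive p]
    by (simp add: pairing_def sum_distrib_left sum_distrib_right)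
  also have "\<dots> = (\<Sum>p1\<in>partitions k. \<Sum>r\<in>?U. \<Sum>q\<in>partitions k.
      a p1 * exclusive k r q * of_nat N ^ nc (join k p1 q))"
    by (intro sum.cong refl sum.swap)
  also have "\<dots> = (\<Sum>r\<in>?U. pairing k N a (exclusive k r))"
    unfolding pairing_def by (rule sum.swap)
  finally have "moment k N p a = (\<Sum>r\<in>?U. pairing k N a (exclusive k r) / of_nat N ^ nc_id k p)"
    by (simp add: moment_def Tr_mult_transp Tr_basis[OF p] sum_divide_distrib)
  also have "\<dots> = (\<Sum>q\<in>?U. of_nat N powi (int (nc_id k q) - int (nc_id k p)) * exclusive_moment k N q a)"
    using N0 by (intro sum.cong refl)
      (simp add: exclusive_moment_def Tr_mult_transp Tr_basis power_int_diff)
  finally show ?thesis .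
qed

text \<open>Expanding every diagram in the exclusive basis and exchanging the sums exhibits these
  numbers as coordinates; uniqueness of coordinates identifies them.\<close>

lemma exclusive_coord_eq:
  assumes a: "a \<in> partition_algebra k" and p: "p \<in> partitions k"
  shows "exclusive_coord k a p = (\<Sum>q | q \<in> partitions k \<and> finer k q p. a q)"
proof -
  let ?P = "partitions k"
  define c where "c p = (if p \<in> ?P then \<Sum>q | q \<in> ?P \<and> finer k q p. a q else 0)" for p
  have "a r = (\<Sum>p\<in>?P. c p * exclusive k p r)" for r
  proof -
    have "a r = (\<Sum>q\<in>?P. a q * basis q r)"
      using a finite_partitions[of k]
      by (auto simp: basis_def partition_algebra_def if_distrib sum.delta cong: if_cong)
    also have "\<dots> = (\<Sum>q\<in>?P. \<Sum>p | p \<in> ?P \<and> finer k q p. a q * exclusive k p r)"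
      by (simp add: exclusive_family_basis[OF is_exclusive_family_exclusive] sum_distrib_left)
    also have "\<dots> = (\<Sum>p\<in>?P. \<Sum>q | q \<in> ?P \<and> finer k q p. a q * exclusive k p r)"
      by (rule sum.swap_restrict[OF finite_partitions finite_partitions])
    also have "\<dots> = (\<Sum>p\<in>?P. c p * exclusive k p r)"
      by (simp add: c_def sum_distrib_right)
    finally show ?thesis .
  qed
  then have "a = (\<lambda>r. \<Sum>p\<in>?P. c p * exclusive k p r)" by (rule ext)
  moreover have "c p = 0" if "p \<notin> ?P" for p using that by (simp add: c_def)
  ultimately have "is_exclusive_coords k a c" unfolding is_exclusive_coords_def by blast
  then have "exclusive_coord k a = c"
    unfolding exclusive_coord_def by (rule the1_equality[OF exclusive_coords_exist1[OF a]])
  then show ?thesis using p by (simp add: c_def)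
qed

text \<open>The exponent is the difference between the normalizing exponents of \<open>p\<close> and
  \<open>q\<close>.\<close>

lemma exclusive_cumulant_eq_sum_cumulant:
  assumes N: "N \<ge> 1" and a: "a \<in> partition_algebra k" and p: "p \<in> partitions k"
  shows "exclusive_cumulant k N p a = (\<Sum>q | q \<in> partitions k \<and> finer k q p. of_nat N powi
    ((int (nc p) - int (nc_id k p)) - (int (nc q) - int (nc_id k q))) * cumulant k N q a)"
proof -
  have N0: "of_nat N \<noteq> (0::complex)" using N by simp
  have "of_nat N powi (i - j) * (of_nat N powi j * z) = (of_nat N powi i * z :: complex)" for i j z
    using N0 by (simp add: power_int_diff)
  then show ?thesis
    by (simp only: exclusive_cumulant_def cumulant_def exclusive_coord_eq[OF a p] sum_distrib_left)
qed

section \<open>Convergence criteria and limit formulas\<close>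

theorem theorem5p2:
  fixes k :: nat and E :: "nat \<Rightarrow> element"
  assumes "\<And>N. N \<ge> 1 \<Longrightarrow> E N \<in> partition_algebra k"
  shows "(converges_in_moments k E \<longleftrightarrow>
            (\<forall>p\<in>partitions k. convergent (\<lambda>N. exclusive_moment k N p (E N)))) \<and>
         (converges_in_moments k E \<longleftrightarrow>
            (\<forall>p\<in>partitions k. convergent (\<lambda>N. exclusive_cumulant k N p (E N)))) \<and>
         (converges_in_moments k E \<longrightarrow>
            (\<forall>p\<in>partitions k. convergent (\<lambda>N. cumulant k N p (E N))) \<and>
            (\<forall>p\<in>partitions k.
               lim (\<lambda>N. moment k N p (E N)) =
                 (\<Sum>p' | p' \<in> partitions k \<and> dashv k p' p.
                    lim (\<lambda>N. exclusive_moment k N p' (E N))) \<and>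
               lim (\<lambda>N. exclusive_cumulant k N p (E N)) =
                 (\<Sum>p' | p' \<in> partitions k \<and> sqsupset k p' p.
                    lim (\<lambda>N. cumulant k N p' (E N)))))"
proof -
  let ?P = "partitions k"
  have less: "nc q < nc p" if "finer k p q" "p \<noteq> q" for p q
    using refines_card_le[OF finite_vertices that(1)] refines_card_eq[OF finite_vertices that(1)] that(2)
    by linarith
  \<comment> \<open>Every pair of diagrams contributes, so \<open>R\<close> is trivial. Up to an
    additive constant, \<open>h\<close> is twice the distance to \<open>id_part k\<close>, and a
    vanishing exponent makes it drop strictly.\<close>
  have 1: "(\<forall>p\<in>?P. convergent (\<lambda>N. moment k N p (E N))) \<longleftrightarrow>
      (\<forall>p\<in>?P. convergent (\<lambda>N. cumulant k N p (E N)))"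
  proof (rule powi_triangular_system(1)[OF finite_partitions, where R = "\<lambda>_ _. True" and
        e = "\<lambda>p q. int (nc (join k p q)) + int (nc_id k q) - int (nc q) - int (nc_id k p)" and
        h = "\<lambda>p. int (nc p) - 2 * int (nc_id k p)"])
    fix p q assume pq: "p \<in> ?P" "q \<in> ?P"
    show "int (nc (join k p q)) + int (nc_id k q) - int (nc q) - int (nc_id k p) \<le> 0"
      using nc_join_nc_id[OF pq] by linarith
    show "int (nc q) - 2 * int (nc_id k q) < int (nc p) - 2 * int (nc_id k p)"
      if "int (nc (join k p q)) + int (nc_id k q) - int (nc q) - int (nc_id k p) = 0" "p \<noteq> q"
      using nc_join_less[OF pq that(2)] that(1) by linarith
  qed (simp_all add: moment_eq_sum_cumulant join_absorb finer_refl)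
  \<comment> \<open>For \<open>q\<close> finer than \<open>p\<close> the join of both is
    \<open>p\<close>, and \<open>nc_join_nc_id\<close> compares the two normalizing
    exponents.\<close>
  have le2: "int (nc p) - int (nc_id k p) - (int (nc q) - int (nc_id k q)) \<le> 0" if "finer k q p" for p q
    using nc_join_nc_id[of p k q] finer_partitions[OF that] join_absorb2[OF that] by simp
  \<comment> \<open>The sum runs over finer diagrams, which have more blocks when different from
    \<open>p\<close>; this explains the sign of \<open>h\<close>. The zero exponents single out
    \<open>sqsupset\<close>.\<close>
  note system2 = powi_triangular_system[OF finite_partitions, where R = "\<lambda>p q. finer k q p" and
        e = "\<lambda>p q. (int (nc p) - int (nc_id k p)) - (int (nc q) - int (nc_id k q))" and
        h = "\<lambda>p. - int (nc p)" and y = "\<lambda>N p. exclusive_cumulant k N p (E N)" and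
        x = "\<lambda>N p. cumulant k N p (E N)",
        OF exclusive_cumulant_eq_sum_cumulant[OF _ assms]]
  have 2: "(\<forall>p\<in>?P. convergent (\<lambda>N. exclusive_cumulant k N p (E N))) \<longleftrightarrow>
      (\<forall>p\<in>?P. convergent (\<lambda>N. cumulant k N p (E N)))"
    by (rule system2(1)) (use le2 less finer_refl in auto)
  have 3: "lim (\<lambda>N. exclusive_cumulant k N p (E N)) =
      (\<Sum>q | q \<in> ?P \<and> sqsupset k q p. lim (\<lambda>N. cumulant k N q (E N)))"
    if "\<forall>p\<in>?P. convergent (\<lambda>N. cumulant k N p (E N))" "p \<in> ?P" for p
  proof -
    have "lim (\<lambda>N. exclusive_cumulant k N p (E N)) = (\<Sum>q | q \<in> ?P \<and> finer k q p \<and>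
        (int (nc p) - int (nc_id k p)) - (int (nc q) - int (nc_id k q)) = 0. lim (\<lambda>N. cumulant k N q (E N)))"
      by (rule system2(2)) (use le2 less finer_refl that in auto)
    also have "\<dots> = (\<Sum>q | q \<in> ?P \<and> sqsupset k q p. lim (\<lambda>N. cumulant k N q (E N)))"
      by (intro sum.cong) (auto simp: sqsupset_def)
    finally show ?thesis .
  qed
  \<comment> \<open>The sum now runs over coarser diagrams, which have fewer blocks when different
    from \<open>p\<close>. The zero exponents single out \<open>dashv\<close>.\<close>
  note system3 = powi_triangular_system[OF finite_partitions, where R = "finer k" and
        e = "\<lambda>p q. int (nc_id k q) - int (nc_id k p)" and
        h = "\<lambda>p. int (nc p)" and y = "\<lambda>N p. moment k N p (E N)" and
        x = "\<lambda>N p. exclusive_moment k N p (E N)", OF moment_eq_sum_exclusive_moment]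
  have 4: "(\<forall>p\<in>?P. convergent (\<lambda>N. moment k N p (E N))) \<longleftrightarrow>
      (\<forall>p\<in>?P. convergent (\<lambda>N. exclusive_moment k N p (E N)))"
    by (rule system3(1)) (use nc_id_antimono less finer_refl in auto)
  have 5: "lim (\<lambda>N. moment k N p (E N)) =
      (\<Sum>q | q \<in> ?P \<and> dashv k q p. lim (\<lambda>N. exclusive_moment k N q (E N)))"
    if "\<forall>p\<in>?P. convergent (\<lambda>N. exclusive_moment k N p (E N))" "p \<in> ?P" for p
  proof -
    have "lim (\<lambda>N. moment k N p (E N)) = (\<Sum>q | q \<in> ?P \<and> finer k p q \<and>
        int (nc_id k q) - int (nc_id k p) = 0. lim (\<lambda>N. exclusive_moment k N q (E N)))"
      by (rule system3(2)) (use nc_id_antimono less finer_refl that in auto)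
    also have "\<dots> = (\<Sum>q | q \<in> ?P \<and> dashv k q p. lim (\<lambda>N. exclusive_moment k N q (E N)))"
      by (intro sum.cong) (auto simp: dashv_def)
    finally show ?thesis .
  qed
  show ?thesis unfolding converges_in_moments_def using 1 2 3 4 5 by auto
qed

end
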